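(* Let $f:X\to\mathbb{R}\cup\{\infty\}$ be a proper function on a real Banach space $(X,\|\cdot\|)$. Suppose there exists a nonempty norm-open subset $A$ of $X^*$ with $A\subseteq\mathrm{Dom}(f^* )$ such that $\mathrm{argmax}(x^*-f)\neq\varnothing$ for each $x^*\in A$. Then there exists a dense and $G_\delta$ subset $R'$ of $A$ such that $(x^*-f):X\to\mathbb{R}\cup\{-\infty\}$ has a strong maximum for each $x^*\in R'$. In addition, if $0\in A$ and $\varepsilon>0$, then there exists an $x_0^*\in X^*$ with $\|x_0^*\|<\varepsilon$ such that $(x_0^*-f):X\to\mathbb{R}\cup\{-\infty\}$ has a strong maximum.
   Context: For a function $g$ with values in $\mathbb{R}\cup\{\infty\}$, $\mathrm{Dom}(g)$ is the set of points where $g<\infty$; $f$ is proper if $\mathrm{Dom}(f)\neq\varnothing$. The Fenchel conjugate $f^*:X^*\to\mathbb{R}\cup\{\infty\}$ of $f$ is $f^*(x^* ):=\sup_{x\in X}[x^*(x)-f(x)]$. For $g:X\to[-\infty,\infty)$, $\mathrm{argmax}(g):=\{x\in X: g(y)\leq g(x)\text{ for all }y\in X\}$. A function $g:X\to[-\infty,\infty)$ has a strong maximum at $x_0\in X$ if $g(x_0)=\sup_{x\in X}g(x)$ and $\lim_{n\to\infty}x_n=x_0$ (in norm) whenever $(x_n)_{n\in\mathbb{N}}$ is a sequence in $X$ with $\lim_{n\to\infty}g(x_n)=\sup_{x\in X}g(x)=g(x_0)$; $g$ has a strong maximum if it has one at some $x_0\in X$. Density and $G_\delta$ are with respect to the relative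 norm topology on $A$. *)

theory Defs
  imports "HOL-Analysis.Analysis"
begin

text \<open>
  Functions into \<open>\<real> \<union> {\<infinity>}\<close> or \<open>[-\<infinity>, \<infinity>)\<close> are \<open>ereal\<close>-valued; the excluded infinite value is ruled
  out by a separate hypothesis where it matters. The dual space of \<open>'a\<close> is the type
  \<open>'a \<Rightarrow>\<^sub>L real\<close> with the operator norm.
\<close>

definition eff_dom :: "('b \<Rightarrow> ereal) \<Rightarrow> 'b set" where
  "eff_dom g = {x. g x < \<infinity>}"

definition proper_fun :: "('b \<Rightarrow> ereal) \<Rightarrow> bool" where
  "proper_fun f \<longleftrightarrow> eff_dom f \<noteq> {}"

text \<open>
  The function \<open>x* - f\<close>. Where \<open>f\<close> is \<open>\<infinity>\<close> its value is \<open>-\<infinity>\<close>.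
\<close>

definition dual_minus ::
  "('a::real_normed_vector \<Rightarrow>\<^sub>L real) \<Rightarrow> ('a \<Rightarrow> ereal) \<Rightarrow> 'a \<Rightarrow> ereal" where
  "dual_minus xs f = (\<lambda>x. ereal (blinfun_apply xs x) - f x)"

definition fenchel_conjugate ::
  "('a::real_normed_vector \<Rightarrow> ereal) \<Rightarrow> ('a \<Rightarrow>\<^sub>L real) \<Rightarrow> ereal" where
  "fenchel_conjugate f xs = (SUP x. ereal (blinfun_apply xs x) - f x)"

definition argmax :: "('b \<Rightarrow> ereal) \<Rightarrow> 'b set" where
  "argmax g = {x. \<forall>y. g y \<le> g x}"

definition strong_maximum_at :: "('a::real_normed_vector \<Rightarrow> ereal) \<Rightarrow> 'a \<Rightarrow> bool" where
  "strong_maximum_at g x0 \<longleftrightarrow>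
     g x0 = (SUP x. g x) \<and>
     (\<forall>s :: nat \<Rightarrow> 'a. (\<lambda>n. g (s n)) \<longlonglongrightarrow> (SUP x. g x) \<longrightarrow> s \<longlonglongrightarrow> x0)"

definition has_strong_maximum :: "('a::real_normed_vector \<Rightarrow> ereal) \<Rightarrow> bool" where
  "has_strong_maximum g \<longleftrightarrow> (\<exists>x0. strong_maximum_at g x0)"

end

theory Submission
  imports Defs "HOL-Library.Diagonal_Subsequence"
begin

text \<open>
  Fix \<open>n\<close> and consider the functionals \<open>z \<in> A\<close> for which some slice of near-maximizers of
  \<open>z - f\<close> lies in a ball of radius \<open>1 / (n + 1)\<close>. These form an open set. If \<open>z\<close> belongs to all
  of them, then every maximizing sequence of \<open>z - f\<close> converges to the maximizer, which is thus a
  strong maximum. By the Baire category theorem it remains to show that each of the sets is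
  dense in \<open>A\<close> (\<open>ex_small_slice\<close>). This can be done locally, where the conjugate is bounded and the
  near-maximizers are bounded in norm (\<open>localization\<close>).

  Suppose that no slice is small on some nonempty open \<open>V \<subseteq> A\<close>. If countably many small balls
  contained a maximizer for every functional in an open subset of \<open>V\<close>, then the Baire category
  theorem would yield a small slice (\<open>small_slice_if_countable_cover\<close>). So the maximizers escape
  from every separable set. Choosing them one after the other, together with functionals that
  vanish on the span of the earlier ones, gives (\<open>escaping_sequence\<close>) functionals \<open>h n\<close> of norm
  at most one and a maximizing sequence \<open>x m\<close> for some \<open>y \<in> V\<close> such that \<open>h n (x m)\<close> is zero for
  \<open>m < n\<close> and bounded below by a positive constant for \<open>n < m\<close>.

  Such an array contradicts attainment by the argument of James and Pryce
  (\<open>james_nonattaining\<close>). After passing to a subsequence whose upper and lower limits cannot be told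
  apart by countably many suprema, and scaling down, one selects convex combinations \<open>g n\<close> and a
  linear functional \<open>l\<close> below their upper limit such that
  \<open>y + (\<Sum>n. q ^ n *\<^sub>R (g n - l))\<close> lies in \<open>V\<close> but does not attain its supremum against \<open>-f\<close>.
\<close>

section \<open>Sublinear functionals and the Hahn--Banach theorem\<close>

definition sublinear :: "('a::real_vector \<Rightarrow> real) \<Rightarrow> bool" where
  "sublinear q \<longleftrightarrow> (\<forall>x y. q (x + y) \<le> q x + q y) \<and> (\<forall>c x. 0 \<le> c \<longrightarrow> q (c *\<^sub>R x) = c * q x)"

lemma sublinear_add: "sublinear q \<Longrightarrow> q (x + y) \<le> q x + q y"
  and sublinear_scale: "sublinear q \<Longrightarrow> 0 \<le> c \<Longrightarrow> q (c *\<^sub>R x) = c * q x"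
  by (auto simp: sublinear_def)

lemma sublinear_zero: "sublinear q \<Longrightarrow> q 0 = 0"
  using sublinear_scale[of q 0 0] by simp

lemma sublinear_neg: "sublinear q \<Longrightarrow> - q (- x) \<le> q x"
  using sublinear_add[of q x "-x"] sublinear_zero[of q] by simp

text \<open>
  One inequality suffices for positive homogeneity: applying it to the inverse factor gives the
  other one.
\<close>

lemma sublinearI_pos:
  assumes "\<And>x y. q (x + y) \<le> q x + q y" "q 0 = 0"
    and le: "\<And>c x. 0 < c \<Longrightarrow> q (c *\<^sub>R x) \<le> c * q x"
  shows "sublinear q"
  unfolding sublinear_def
proof (intro conjI allI impI)
  fix c :: real and x assume "0 \<le> c"
  show "q (c *\<^sub>R x) = c * q x"
  proof (cases "c = 0")
    case False
    with \<open>0 \<le> c\<close> have c: "0 < c" by simp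
    have "q x \<le> inverse c * q (c *\<^sub>R x)" using le[of "inverse c" "c *\<^sub>R x"] c by simp
    then have "c * q x \<le> q (c *\<^sub>R x)" using c by (simp add: field_simps)
    with le[OF c, of x] show ?thesis by simp
  qed (use assms in simp)
qed (use assms in auto)

text \<open>
  The largest sublinear functional below a sublinear \<open>q\<close> whose value at \<open>- a\<close> is at most
  \<open>- q a\<close>. Every linear functional below it takes the value \<open>q a\<close> at \<open>a\<close>.
\<close>

definition slope_in :: "'a::real_vector \<Rightarrow> ('a \<Rightarrow> real) \<Rightarrow> 'a \<Rightarrow> real" where
  "slope_in a q x = (INF t\<in>{0..}. q (x + t *\<^sub>R a) - t * q a)"

lemma slope_in_props:
  assumes q: "sublinear q"
  shows "sublinear (slope_in a q)" "slope_in a q x \<le> q x" "slope_in a q (- a) \<le> - q a"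
proof -
  have low: "- q (- x) \<le> q (x + t *\<^sub>R a) - t * q a" if "0 \<le> t" for x t
    using sublinear_add[OF q, of "x + t *\<^sub>R a" "- x"] sublinear_scale[OF q that, of a] by simp
  have bdd: "bdd_below ((\<lambda>t. q (x + t *\<^sub>R a) - t * q a) ` {0..})" for x
    using low[of _ x] by (intro bdd_belowI[of _ "- q (- x)"]) auto
  have le: "slope_in a q x \<le> q (x + t *\<^sub>R a) - t * q a" if "0 \<le> t" for x t
    unfolding slope_in_def using that by (intro cINF_lower bdd) auto
  have ge: "b \<le> slope_in a q x" if "\<And>t. 0 \<le> t \<Longrightarrow> b \<le> q (x + t *\<^sub>R a) - t * q a" for b x
    unfolding slope_in_def using that by (intro cINF_greatest) auto
  show "slope_in a q x \<le> q x" using le[of 0 x] by simp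
  show "slope_in a q (- a) \<le> - q a" using le[of 1 "- a"] sublinear_zero[OF q] by simp
  show "sublinear (slope_in a q)"
  proof (rule sublinearI_pos)
    fix x y
    have "slope_in a q (x + y) - (q (x + s *\<^sub>R a) - s * q a) \<le> q (y + t *\<^sub>R a) - t * q a"
      if "0 \<le> s" "0 \<le> t" for s t
      using le[of "s + t" "x + y"] that sublinear_add[OF q, of "x + s *\<^sub>R a" "y + t *\<^sub>R a"]
      by (simp add: algebra_simps)
    then have "slope_in a q (x + y) - (q (x + s *\<^sub>R a) - s * q a) \<le> slope_in a q y" if "0 \<le> s" for s
      using that by (intro ge) auto
    then have "slope_in a q (x + y) - slope_in a q y \<le> slope_in a q x"
      by (intro ge) (force simp: algebra_simps)
    then show "slope_in a q (x + y) \<le> slope_in a q x + slope_in a q y" by simp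
  next
    have "slope_in a q 0 \<le> 0" using le[of 0 0] sublinear_zero[OF q] by simp
    moreover have "0 \<le> slope_in a q 0"
      by (rule ge) (simp add: sublinear_scale[OF q])
    ultimately show "slope_in a q 0 = 0" by simp
  next
    fix c :: real and x assume c: "0 < c"
    have "inverse c * slope_in a q (c *\<^sub>R x) \<le> slope_in a q x"
    proof (rule ge)
      fix t :: real assume t: "0 \<le> t"
      have "q (c *\<^sub>R x + (c * t) *\<^sub>R a) = c * q (x + t *\<^sub>R a)"
        using sublinear_scale[OF q, of c "x + t *\<^sub>R a"] c by (simp add: algebra_simps)
      then have "slope_in a q (c *\<^sub>R x) \<le> c * (q (x + t *\<^sub>R a) - t * q a)"
        using le[of "c * t" "c *\<^sub>R x"] c t by (simp add: algebra_simps)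
      then show "inverse c * slope_in a q (c *\<^sub>R x) \<le> q (x + t *\<^sub>R a) - t * q a"
        using c by (simp add: field_simps)
    qed
    then show "slope_in a q (c *\<^sub>R x) \<le> c * slope_in a q x" using c by (simp add: field_simps)
  qed
qed

text \<open>
  Zorn's lemma applies because the pointwise infimum of a chain of sublinear functionals below
  \<open>p\<close> is again sublinear: it is finite, since every member is at least \<open>- p (- x)\<close> at \<open>x\<close>.
\<close>

lemma ex_minimal_sublinear:
  assumes p: "sublinear (p :: 'a::real_vector \<Rightarrow> real)"
  obtains q where "sublinear q" "q \<le> p" "\<And>q'. sublinear q' \<Longrightarrow> q' \<le> q \<Longrightarrow> q' = q"
proof -
  define S where "S = {q. sublinear q \<and> q \<le> p}"
  have "\<exists>m\<in>S. \<forall>q\<in>S. q \<le> m \<longrightarrow> q = m"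
  proof (rule predicate_Zorn)
    show "partial_order_on S (relation_of (\<lambda>a b. b \<le> a) S)"
      by (rule partial_order_on_relation_ofI) auto
  next
    fix C assume "C \<in> Chains (relation_of (\<lambda>a b. b \<le> a) S)"
    then have CS: "C \<subseteq> S" and tot: "\<And>a b. a \<in> C \<Longrightarrow> b \<in> C \<Longrightarrow> a \<le> b \<or> b \<le> a"
      unfolding Chains_def relation_of_def by auto
    show "\<exists>u\<in>S. \<forall>a\<in>C. u \<le> a"
    proof (cases "C = {}")
      case True
      then show ?thesis using p by (auto simp: S_def)
    next
      case False
      define u where "u x = (INF q\<in>C. q x)" for x
      have sub: "sublinear q" and lep: "q x \<le> p x" if "q \<in> C" for q x
        using CS that by (auto simp: S_def le_fun_def)
      have bdd: "bdd_below ((\<lambda>q. q x) ` C)" for x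
      proof (rule bdd_belowI)
        fix r assume "r \<in> (\<lambda>q. q x) ` C"
        then obtain q where "q \<in> C" "r = q x" by auto
        then show "- p (- x) \<le> r"
          using sublinear_neg[OF sub, of q x] lep[of q "- x"] by simp
      qed
      have ule: "u x \<le> q x" if "q \<in> C" for q x
        unfolding u_def using that by (intro cINF_lower bdd) auto
      have uge: "b \<le> u x" if "\<And>q. q \<in> C \<Longrightarrow> b \<le> q x" for b x
        unfolding u_def using that False by (intro cINF_greatest) auto
      have "sublinear u"
      proof (rule sublinearI_pos)
        fix x y
        have "u (x + y) - q x \<le> q' y" if qC: "q \<in> C" "q' \<in> C" for q q'
        proof -
          obtain m where m: "m \<in> C" "m x \<le> q x" "m y \<le> q' y"
            using tot[OF \<open>q \<in> C\<close> \<open>q' \<in> C\<close>] \<open>q \<in> C\<close> \<open>q' \<in> C\<close> by (metis le_funD order_refl)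
          have "u (x + y) \<le> m x + m y"
            using ule[OF m(1), of "x + y"] sublinear_add[OF sub[OF m(1)], of x y] by simp
          then show ?thesis using m by simp
        qed
        then have "u (x + y) - q x \<le> u y" if "q \<in> C" for q using that by (intro uge) auto
        then have "u (x + y) - u y \<le> u x" by (intro uge) (force simp: algebra_simps)
        then show "u (x + y) \<le> u x + u y" by simp
      next
        obtain q where "q \<in> C" using False by blast
        then show "u 0 = 0"
          using ule[of q 0] uge[of 0 0] sublinear_zero[OF sub] by (force intro: antisym)
      next
        fix c :: real and x assume c: "0 < c"
        have "inverse c * u (c *\<^sub>R x) \<le> u x"
        proof (rule uge)
          fix q assume q: "q \<in> C"
          show "inverse c * u (c *\<^sub>R x) \<le> q x"
            using ule[OF q, of "c *\<^sub>R x"] sublinear_scale[OF sub[OF q], of c x] c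
            by (simp add: field_simps)
        qed
        then show "u (c *\<^sub>R x) \<le> c * u x" using c by (simp add: field_simps)
      qed
      moreover have "u \<le> p" using False ule lep unfolding le_fun_def by (meson all_not_in_conv order_trans)
      ultimately show ?thesis using ule by (auto simp: S_def le_fun_def)
    qed
  qed
  then show ?thesis using that unfolding S_def by (metis (mono_tags, lifting) mem_Collect_eq order_trans)
qed

text \<open>
  A minimal sublinear functional \<open>h\<close> is odd, since relaxing it in any direction \<open>x\<close> by
  \<^const>\<open>slope_in\<close> cannot make it smaller, and an odd sublinear functional is linear. Starting
  the minimization from the relaxation of \<open>p\<close> in the direction \<open>a\<close> forces equality at \<open>a\<close>.
\<close>

theorem hahn_banach_dominated:
  assumes p: "sublinear (p :: 'a::real_vector \<Rightarrow> real)"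
  obtains h where "linear h" "\<And>x. h x \<le> p x" "h a = p a"
proof -
  obtain h where h: "sublinear h" "h \<le> slope_in a p" "\<And>q'. sublinear q' \<Longrightarrow> q' \<le> h \<Longrightarrow> q' = h"
    using ex_minimal_sublinear[OF slope_in_props(1)[OF p, of a]] by blast
  have "h (- x) \<le> - h x" for x
    using h(3)[of "slope_in x h"] slope_in_props[OF h(1), of x] by (metis le_funI)
  then have neg: "h (- x) = - h x" for x using sublinear_neg[OF h(1), of "- x"]
    by (smt (verit) minus_minus)
  have "h (x + y) = h x + h y" for x y
    using sublinear_add[OF h(1), of x y] sublinear_add[OF h(1), of "x + y" "- y"] neg[of y] by simp
  moreover have "h (c *\<^sub>R x) = c * h x" for c x
    using sublinear_scale[OF h(1), of "\<bar>c\<bar>" x] neg[of "\<bar>c\<bar> *\<^sub>R x"] by (cases "0 \<le> c") auto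
  ultimately have "linear h" by (intro linearI) auto
  moreover have hp: "h x \<le> p x" for x
    using h(2) slope_in_props(2)[OF p, of a x] by (meson le_fun_def order_trans)
  moreover have "h a = p a"
    using h(2) slope_in_props(3)[OF p, of a] neg[of a] hp[of a] by (smt (verit) le_fun_def)
  ultimately show ?thesis using that by blast
qed

lemma hahn_banach_blinfun:
  fixes p :: "'a::real_normed_vector \<Rightarrow> real"
  assumes p: "sublinear p"
    and K: "\<And>x. p x \<le> K * norm x" "0 \<le> K"
  obtains h :: "'a \<Rightarrow>\<^sub>L real" where "\<And>x. blinfun_apply h x \<le> p x" "blinfun_apply h a = p a" "norm h \<le> K"
proof -
  obtain h where h: "linear h" "\<And>x. h x \<le> p x" "h a = p a"
    using hahn_banach_dominated[OF p] by blast
  have bd: "\<bar>h x\<bar> \<le> norm x * K" for x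
    using h(2)[of x] h(2)[of "- x"] K(1)[of x] K(1)[of "- x"] linear_neg[OF h(1), of x]
    by (auto simp: mult.commute)
  have bl: "bounded_linear h"
    using h(1) bd by (auto simp: bounded_linear_def bounded_linear_axioms_def)
  have eq: "blinfun_apply (Blinfun h) = h" using bl by (rule bounded_linear_Blinfun_apply)
  have "norm (Blinfun h) \<le> K"
    using K(2) bd by (intro norm_blinfun_bound) (auto simp: eq mult.commute)
  then show ?thesis using that[of "Blinfun h"] h by (simp add: eq)
qed

lemma norming_functional:
  fixes x :: "'a::real_normed_vector"
  obtains u :: "'a \<Rightarrow>\<^sub>L real" where "blinfun_apply u x = norm x" "norm u \<le> 1"
  by (rule hahn_banach_blinfun[of norm 1 x])
    (auto simp: sublinear_def norm_triangle_ineq)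

lemma blinfun_le_norm: "blinfun_apply (u :: 'a::real_normed_vector \<Rightarrow>\<^sub>L real) x \<le> norm u * norm x"
  using norm_blinfun[of u x] by simp

section \<open>Countable sets closed under rational combinations\<close>

definition rat_closed :: "'a::real_vector set \<Rightarrow> bool" where
  "rat_closed C \<longleftrightarrow> (\<forall>a\<in>C. \<forall>b\<in>C. \<forall>s\<in>\<rat>. \<forall>t\<in>\<rat>. s *\<^sub>R a + t *\<^sub>R b \<in> C)"

lemma rat_closed_scale_add:
  "rat_closed C \<Longrightarrow> a \<in> C \<Longrightarrow> b \<in> C \<Longrightarrow> s \<in> \<rat> \<Longrightarrow> t \<in> \<rat> \<Longrightarrow> s *\<^sub>R a + t *\<^sub>R b \<in> C"
  by (simp add: rat_closed_def)

lemma ex_countable_rat_closed: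
  assumes "countable (H :: 'a::real_vector set)"
  obtains C where "countable C" "H \<subseteq> C" "0 \<in> C" "rat_closed C"
proof -
  define C where "C n = ((\<lambda>C. C \<union> (\<lambda>(a, b, s, t). s *\<^sub>R a + t *\<^sub>R b) ` (C \<times> C \<times> \<rat> \<times> \<rat>)) ^^ n)
     (insert 0 H)" for n
  have C_Suc: "C (Suc n) = C n \<union> (\<lambda>(a, b, s, t). s *\<^sub>R a + t *\<^sub>R b) ` (C n \<times> C n \<times> \<rat> \<times> \<rat>)" for n
    by (simp add: C_def)
  have "countable (C n)" for n
  proof (induction n)
    case (Suc n) then show ?case unfolding C_Suc by (auto intro!: countable_Un countable_image countable_SIGMA countable_rat)
  qed (use assms in \<open>simp add: C_def\<close>)
  moreover have mono: "mono C" unfolding mono_iff_le_Suc C_Suc by auto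
  have "rat_closed (\<Union>n. C n)"
    unfolding rat_closed_def
  proof (intro ballI)
    fix a b :: 'a and s t :: real assume "a \<in> (\<Union>n. C n)" "b \<in> (\<Union>n. C n)" and st: "s \<in> \<rat>" "t \<in> \<rat>"
    then obtain m n where "a \<in> C m" "b \<in> C n" by auto
    then have "a \<in> C (max m n)" "b \<in> C (max m n)"
      using mono by (meson max.cobounded1 max.cobounded2 monoD subsetD)+
    then have "s *\<^sub>R a + t *\<^sub>R b \<in> C (Suc (max m n))"
      unfolding C_Suc using st by force
    then show "s *\<^sub>R a + t *\<^sub>R b \<in> (\<Union>n. C n)" by blast
  qed
  moreover have "insert 0 H = C 0" by (simp add: C_def)
  then have "insert 0 H \<subseteq> (\<Union>n. C n)" by blast
  ultimately show ?thesis using that[of "\<Union>n. C n"] by auto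
qed

text \<open>
  The closure is closed under real multiples because the rationals are dense.
\<close>

lemma span_subset_closure_rat_closed:
  assumes C: "rat_closed (C :: 'a::real_normed_vector set)" "0 \<in> C"
  shows "span C \<subseteq> closure C"
proof (rule span_minimal[OF closure_subset])
  show "subspace (closure C)"
  proof (rule subspaceI)
    show "0 \<in> closure C" using C closure_subset by blast
  next
    fix x y assume "x \<in> closure C" "y \<in> closure C"
    then obtain a b where "\<And>n. a n \<in> C" "a \<longlonglongrightarrow> x" "\<And>n. b n \<in> C" "b \<longlonglongrightarrow> y"
      by (auto simp: closure_sequential)
    then have "(\<lambda>n. a n + b n) \<longlonglongrightarrow> x + y" "\<And>n. a n + b n \<in> C"
      using rat_closed_scale_add[OF C(1), of _ _ 1 1] by (auto intro: tendsto_add)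
    then show "x + y \<in> closure C" unfolding closure_sequential by (intro exI[of _ "\<lambda>n. a n + b n"]) simp
  next
    fix x and c :: real assume "x \<in> closure C"
    then obtain a where a: "\<And>n. a n \<in> C" "a \<longlonglongrightarrow> x" by (auto simp: closure_sequential)
    have "c \<in> closure \<rat>" by (simp add: Rats_closure_real)
    then obtain q where q: "\<And>n. q n \<in> \<rat>" "q \<longlonglongrightarrow> c" by (auto simp: closure_sequential)
    have "(\<lambda>n. q n *\<^sub>R a n) \<longlonglongrightarrow> c *\<^sub>R x" using a q by (intro tendsto_scaleR)
    moreover have "q n *\<^sub>R a n \<in> C" for n
      using rat_closed_scale_add[OF C(1) a(1) a(1) q(1) Rats_0, of n n n] by simp
    ultimately show "c *\<^sub>R x \<in> closure C"
      unfolding closure_sequential by (intro exI[of _ "\<lambda>n. q n *\<^sub>R a n"]) simp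
  qed
qed

section \<open>Bounded payoffs and a Baire argument for separable ranges\<close>

text \<open>
  The form in which the Baire category theorem is used: a countable closed cover of one ball
  already has a member with interior points.
\<close>

lemma Baire_ball_cover:
  fixes y :: "'b::complete_space"
  assumes "0 < r" "countable \<G>" and cl: "\<forall>E\<in>\<G>. closed E" and cov: "ball y r \<subseteq> \<Union>\<G>"
  shows "\<exists>E\<in>\<G>. \<exists>z. \<exists>t>0. ball z t \<subseteq> E"
proof -
  have "\<exists>E\<in>\<G>. interior E \<noteq> {}"
  proof (rule ccontr)
    assume "\<not> ?thesis"
    then have "Met_TC.mtopology interior_of \<Union>\<G> = {}"
      using cl by (intro Met_TC.metric_Baire_category_alt \<open>countable \<G>\<close>)
        (auto simp: complete_UNIV)
    moreover have "y \<in> interior (\<Union>\<G>)" using cov \<open>0 < r\<close> by (meson centre_in_ball interior_maximal open_ball subsetD)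
    ultimately show False by simp
  qed
  then show ?thesis by (auto simp: mem_interior)
qed

text \<open>
  The localized problem. Here \<open>F\<close> stands for \<open>-f\<close>, and \<open>D\<close> for the part of the domain of
  \<open>f\<close> that contains the near-maximizers for all functionals near a given one. With \<open>D\<close> bounded and \<open>F\<close>
  bounded above, the supremum of \<open>F + z\<close> is finite for every functional \<open>z\<close> and Lipschitz in
  \<open>z\<close>. The perturbations in \<open>psup\<close> are arbitrary functions, since a nonlinear upper limit of
  functionals will be one of them.
\<close>

locale bounded_payoff =
  fixes D :: "'a::real_normed_vector set" and F :: "'a \<Rightarrow> real" and R M :: real
  assumes D_nonempty: "D \<noteq> {}"
    and D_bound: "x \<in> D \<Longrightarrow> norm x \<le> R"
    and F_bound: "x \<in> D \<Longrightarrow> F x \<le> M"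
    and R_pos: "0 < R"
begin

definition psup :: "('a \<Rightarrow> real) \<Rightarrow> real" where
  "psup \<psi> = (SUP x\<in>D. F x + \<psi> x)"

lemma psup_upper:
  assumes "bdd_above (\<psi> ` D)" "x \<in> D" shows "F x + \<psi> x \<le> psup \<psi>"
proof -
  obtain K where "\<And>x. x \<in> D \<Longrightarrow> \<psi> x \<le> K" using assms(1) by (auto simp: bdd_above_def)
  then have "bdd_above ((\<lambda>x. F x + \<psi> x) ` D)"
    using F_bound by (intro bdd_aboveI[of _ "M + K"]) (auto intro: add_mono)
  then show ?thesis unfolding psup_def using assms(2) by (intro cSUP_upper)
qed

lemma psup_least: "(\<And>x. x \<in> D \<Longrightarrow> F x + \<psi> x \<le> c) \<Longrightarrow> psup \<psi> \<le> c"
  unfolding psup_def using D_nonempty by (intro cSUP_least) auto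

lemma psup_mono:
  assumes "bdd_above (\<psi>' ` D)" "\<And>x. x \<in> D \<Longrightarrow> \<psi> x \<le> \<psi>' x + c"
  shows "psup \<psi> \<le> psup \<psi>' + c"
  using psup_upper[OF assms(1)] assms(2) by (intro psup_least) force

lemma psup_convex:
  assumes bd: "bdd_above (\<psi> ` D)" "bdd_above (\<psi>' ` D)" and st: "0 \<le> s" "0 \<le> t" "s + t = 1"
  shows "psup (\<lambda>x. s * \<psi> x + t * \<psi>' x) \<le> s * psup \<psi> + t * psup \<psi>'"
proof (rule psup_least)
  fix x assume x: "x \<in> D"
  have "F x + (s * \<psi> x + t * \<psi>' x) = s * (F x + \<psi> x) + t * (F x + \<psi>' x)"
    using st(3) by (simp add: algebra_simps flip: distrib_right)
  also have "\<dots> \<le> s * psup \<psi> + t * psup \<psi>'"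
    using psup_upper[OF bd(1) x] psup_upper[OF bd(2) x] st by (intro add_mono mult_left_mono) auto
  finally show "F x + (s * \<psi> x + t * \<psi>' x) \<le> s * psup \<psi> + t * psup \<psi>'" .
qed

lemma blinfun_bound: "x \<in> D \<Longrightarrow> \<bar>blinfun_apply (z :: 'a \<Rightarrow>\<^sub>L real) x\<bar> \<le> norm z * R"
  using norm_blinfun[of z x] D_bound[of x] mult_left_mono[of "norm x" R "norm z"] by simp

lemma bdd_blinfun: "bdd_above (blinfun_apply (z :: 'a \<Rightarrow>\<^sub>L real) ` D)"
  by (rule bdd_aboveI[of _ "norm z * R"]) (use blinfun_bound in \<open>force simp: abs_le_iff\<close>)

lemma psup_lipschitz: "psup (blinfun_apply z) \<le> psup (blinfun_apply z') + dist z z' * R"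
proof (rule psup_mono[OF bdd_blinfun])
  fix x assume "x \<in> D"
  then show "blinfun_apply z x \<le> blinfun_apply z' x + dist z z' * R"
    using blinfun_bound[of x "z - z'"] by (simp add: dist_norm blinfun.diff_left)
qed

definition slice :: "('a \<Rightarrow>\<^sub>L real) \<Rightarrow> real \<Rightarrow> 'a set" where
  "slice z \<delta> = {x \<in> D. psup (blinfun_apply z) - \<delta> < F x + blinfun_apply z x}"

definition attained :: "('a \<Rightarrow>\<^sub>L real) \<Rightarrow> bool" where
  "attained z \<longleftrightarrow> (\<exists>x\<in>D. F x + blinfun_apply z x = psup (blinfun_apply z))"

lemma slice_subset_slice:
  assumes "\<delta> + 2 * (dist z z' * R) \<le> \<delta>'" shows "slice z \<delta> \<subseteq> slice z' \<delta>'"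
proof
  fix x assume x: "x \<in> slice z \<delta>"
  then have "x \<in> D" by (simp add: slice_def)
  then have "blinfun_apply z x \<le> blinfun_apply z' x + dist z z' * R"
    using blinfun_bound[of x "z - z'"] by (simp add: dist_norm blinfun.diff_left)
  then show "x \<in> slice z' \<delta>'"
    using x assms psup_lipschitz[of z' z] by (auto simp: slice_def dist_commute)
qed

text \<open>
  By the Baire category theorem, one ball \<open>cball q \<epsilon>\<close> of the cover carries near-maximizers for
  every functional near some \<open>z\<close>. Then a slice at \<open>z\<close> cannot reach a point \<open>x\<close> much further
  away from \<open>q\<close>: tilting \<open>z\<close> in the direction of a functional that norms \<open>x - q\<close> would favour
  \<open>x\<close> over the whole ball. This settles the theorem when the maximizers lie in a separable
  set.
\<close>

lemma small_slice_if_countable_cover: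
  assumes r: "0 < r" and Q: "countable Q" and \<epsilon>: "0 < \<epsilon>"
    and cov: "\<And>z. z \<in> ball y r \<Longrightarrow>
      \<exists>q\<in>Q. \<exists>x\<in>D \<inter> cball q \<epsilon>. F x + blinfun_apply z x = psup (blinfun_apply z)"
  obtains z \<delta> q where "z \<in> ball y r" "0 < \<delta>" "slice z \<delta> \<subseteq> cball q (2 * \<epsilon>)"
proof -
  define E where "E q = {z \<in> cball y (r / 2). \<forall>\<delta>>0. slice z \<delta> \<inter> cball q \<epsilon> \<noteq> {}}" for q
  have closed_E: "\<forall>S\<in>E ` Q. closed S"
  proof (rule ballI, erule imageE, erule ssubst, unfold closed_sequential_limits, intro allI impI, elim conjE)
    fix q zs z assume zs: "\<forall>n. zs n \<in> E q" and lim: "zs \<longlonglongrightarrow> z"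
    have "z \<in> cball y (r / 2)"
      by (rule closed_sequentially[OF closed_cball _ lim]) (use zs in \<open>auto simp: E_def\<close>)
    moreover have "slice z \<delta> \<inter> cball q \<epsilon> \<noteq> {}" if \<delta>: "0 < \<delta>" for \<delta>
    proof -
      obtain n where "dist (zs n) z < \<delta> / (4 * R)"
        using lim[unfolded lim_sequentially, rule_format, of "\<delta> / (4 * R)"] \<delta> R_pos
        by (metis divide_pos_pos mult_pos_pos order_refl zero_less_numeral)
      then have "slice (zs n) (\<delta> / 2) \<subseteq> slice z \<delta>"
        using R_pos by (intro slice_subset_slice) (simp add: field_simps)
      moreover have "slice (zs n) (\<delta> / 2) \<inter> cball q \<epsilon> \<noteq> {}" using zs that by (auto simp: E_def)
      ultimately show ?thesis by blast
    qed
    ultimately show "z \<in> E q" by (simp add: E_def)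
  qed
  have cover_E: "ball y (r / 2) \<subseteq> \<Union>(E ` Q)"
  proof
    fix z assume z: "z \<in> ball y (r / 2)"
    then obtain q x where "q \<in> Q" "x \<in> D" "x \<in> cball q \<epsilon>" "F x + blinfun_apply z x = psup (blinfun_apply z)"
      using cov[of z] r by auto
    then have "z \<in> E q" using z by (force simp: E_def slice_def)
    with \<open>q \<in> Q\<close> show "z \<in> \<Union>(E ` Q)" by blast
  qed
  have "\<exists>S\<in>E ` Q. \<exists>z. \<exists>t>0. ball z t \<subseteq> S"
    by (rule Baire_ball_cover[OF half_gt_zero[OF r] countable_image[OF Q] closed_E cover_E])
  then obtain q z t where qzt: "q \<in> Q" "0 < t" "ball z t \<subseteq> E q" by blast
  have "z \<in> E q" using qzt by (meson centre_in_ball subsetD)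
  then have "z \<in> ball y r" using r by (auto simp: E_def)
  moreover define s where "s = t / 2"
  have s: "0 < s" "s < t" using qzt by (auto simp: s_def)
  moreover have "slice z (s * \<epsilon> / 2) \<subseteq> cball q (2 * \<epsilon>)"
  proof
    fix x assume x: "x \<in> slice z (s * \<epsilon> / 2)"
    show "x \<in> cball q (2 * \<epsilon>)"
    proof (rule ccontr)
      assume "x \<notin> cball q (2 * \<epsilon>)"
      then have far: "2 * \<epsilon> < norm (x - q)" by (simp add: dist_norm norm_minus_commute)
      obtain u :: "'a \<Rightarrow>\<^sub>L real" where u: "blinfun_apply u (x - q) = norm (x - q)" "norm u \<le> 1"
        by (rule norming_functional)
      \<comment> \<open>The tilted functional \<open>z + s u\<close> still has near-maximizers in \<open>cball q \<epsilon>\<close>, but \<open>x\<close> beats them.\<close>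
      have "s * norm u \<le> s * 1" using u(2) s(1) by (intro mult_left_mono) auto
      moreover have "norm (s *\<^sub>R u) = s * norm u" using s(1) by simp
      ultimately have "norm (s *\<^sub>R u) < t" using s(2) by linarith
      then have "z + s *\<^sub>R u \<in> E q" using qzt(3) by (auto simp: dist_norm)
      moreover have "0 < s * \<epsilon> / 2" using s \<epsilon> by simp
      ultimately obtain w where w: "w \<in> slice (z + s *\<^sub>R u) (s * \<epsilon> / 2)" "w \<in> cball q \<epsilon>"
        unfolding E_def by blast
      have "blinfun_apply u (w - q) \<le> \<epsilon>"
        using blinfun_le_norm[of u "w - q"] u(2) w(2) mult_right_mono[of "norm u" 1 "norm (w - q)"]
        by (simp add: dist_norm norm_minus_commute)
      then have uw: "blinfun_apply u w \<le> blinfun_apply u q + \<epsilon>" by (simp add: blinfun.diff_right)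
      have ux: "blinfun_apply u q + 2 * \<epsilon> < blinfun_apply u x"
        using u(1) far by (simp add: blinfun.diff_right)
      have "s * blinfun_apply u w + s * \<epsilon> \<le> s * blinfun_apply u x"
        using uw ux s(1) by (simp flip: distrib_left)
      moreover have "F x + blinfun_apply (z + s *\<^sub>R u) x \<le> psup (blinfun_apply (z + s *\<^sub>R u))"
        "F w + blinfun_apply z w \<le> psup (blinfun_apply z)"
        using x w by (auto intro!: psup_upper bdd_blinfun simp: slice_def)
      ultimately show False
        using x w(1) by (simp add: slice_def blinfun.add_left blinfun.scaleR_left)
    qed
  qed
  moreover have "0 < s * \<epsilon> / 2" using s \<epsilon> by simp
  ultimately show ?thesis using that by blast
qed

end

section \<open>Escape from countable sets when no slice is small\<close>

lemma sublinear_infdist_subspace: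
  assumes S: "subspace (S :: 'a::real_normed_vector set)"
  shows "sublinear (\<lambda>x. infdist x S)"
proof -
  have ne: "S \<noteq> {}" using subspace_0[OF S] by auto
  have ge: "b \<le> infdist x S" if "\<And>s. s \<in> S \<Longrightarrow> b \<le> dist x s" for b x
    using ne that by (auto simp: infdist_def intro: cINF_greatest)
  show ?thesis
  proof (rule sublinearI_pos)
    fix x y
    have "infdist (x + y) S - dist x s \<le> dist y t" if "s \<in> S" "t \<in> S" for s t
      using infdist_le[OF subspace_add[OF S that], of "x + y"] dist_triangle_add[of x y s t] by simp
    then have "infdist (x + y) S - dist x s \<le> infdist y S" if "s \<in> S" for s
      using that by (intro ge) auto
    then have "infdist (x + y) S - infdist y S \<le> infdist x S"
      by (intro ge) (force simp: algebra_simps)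
    then show "infdist (x + y) S \<le> infdist x S + infdist y S" by simp
  next
    show "infdist 0 S = 0" using subspace_0[OF S] by simp
  next
    fix c :: real and x assume c: "0 < c"
    have "inverse c * infdist (c *\<^sub>R x) S \<le> infdist x S"
    proof (rule ge)
      fix s assume "s \<in> S"
      then have "infdist (c *\<^sub>R x) S \<le> dist (c *\<^sub>R x) (c *\<^sub>R s)"
        by (intro infdist_le subspace_scale[OF S])
      also have "\<dots> = c * dist x s" using c by (simp add: dist_norm flip: scaleR_diff_right)
      finally show "inverse c * infdist (c *\<^sub>R x) S \<le> dist x s" using c by (simp add: field_simps)
    qed
    then show "infdist (c *\<^sub>R x) S \<le> c * infdist x S" using c by (simp add: field_simps)
  qed
qed

context bounded_payoff begin

text \<open>
  If no slice is small, then by \<open>small_slice_if_countable_cover\<close> a countable set cannot come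
  \<open>\<epsilon>\<close>-close to a maximizer for each functional near \<open>z\<close>. For the rational span of a finite
  set \<open>X\<close> this yields a maximizer \<open>x\<close> at distance at least \<open>\<epsilon>\<close> from the span of \<open>X\<close>, and
  a functional \<open>h\<close> of norm at most one that vanishes on \<open>X\<close> and is at least \<open>\<epsilon>\<close> at \<open>x\<close>. A small tilt in
  the direction \<open>h\<close> makes \<open>h\<close> large on an entire slice, so that the bound persists for all
  points chosen later.
\<close>

lemma escape_step:
  assumes att: "\<forall>v\<in>cball z \<delta>. attained v"
    and large: "\<forall>v\<in>cball z \<delta>. \<forall>\<eta>>0. \<forall>q. \<not> slice v \<eta> \<subseteq> cball q (2 * \<epsilon>)"
    and pos: "0 < \<epsilon>" "0 < \<delta>" and X: "finite X"
  shows "\<exists>x h z' \<delta>'. x \<in> slice z \<delta> \<and> norm h \<le> 1 \<and> (\<forall>a\<in>X. blinfun_apply h a = 0) \<and>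
    0 < \<delta>' \<and> \<delta>' \<le> \<delta> / 2 \<and> cball z' \<delta>' \<subseteq> cball z \<delta> \<and> slice z' \<delta>' \<subseteq> slice z \<delta> \<and>
    (\<forall>w\<in>slice z' \<delta>'. \<epsilon> / 2 \<le> blinfun_apply h w)"
proof -
  obtain C where C: "countable C" "X \<subseteq> C" "0 \<in> C" "rat_closed C"
    using ex_countable_rat_closed[OF countable_finite[OF X]] by metis
  define r where "r = min (\<delta> / 4) (\<delta> / (8 * R))"
  have r: "0 < r" "r \<le> \<delta> / 4" "4 * (r * R) \<le> \<delta> / 2"
  proof -
    have "r \<le> \<delta> / (8 * R)" by (simp add: r_def)
    then have "r * R \<le> \<delta> / (8 * R) * R" using R_pos by (intro mult_right_mono) auto
    then show "4 * (r * R) \<le> \<delta> / 2" using R_pos by simp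
  qed (use pos R_pos in \<open>auto simp: r_def\<close>)
  have sub: "ball z r \<subseteq> cball z \<delta>" using r pos by auto
  have "\<exists>v\<in>ball z r. \<forall>q\<in>C. \<forall>x\<in>D \<inter> cball q \<epsilon>. F x + blinfun_apply v x \<noteq> psup (blinfun_apply v)"
  proof (rule ccontr)
    assume "\<not> ?thesis"
    then obtain v \<eta> q where "v \<in> ball z r" "0 < \<eta>" "slice v \<eta> \<subseteq> cball q (2 * \<epsilon>)"
      using small_slice_if_countable_cover[OF r(1) C(1) pos(1), of z] by blast
    with large sub show False by blast
  qed
  then obtain v where v: "v \<in> ball z r"
    "\<And>q x. q \<in> C \<Longrightarrow> x \<in> D \<inter> cball q \<epsilon> \<Longrightarrow> F x + blinfun_apply v x \<noteq> psup (blinfun_apply v)"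
    by blast
  have "attained v" using v(1) sub att by blast
  then obtain x where x: "x \<in> D" "F x + blinfun_apply v x = psup (blinfun_apply v)"
    by (auto simp: attained_def)
  have "closure C \<subseteq> {s. \<epsilon> \<le> dist x s}"
    using v(2)[of _ x] x
    by (intro closure_minimal closed_Collect_le continuous_intros) (force simp: dist_commute)
  then have "\<epsilon> \<le> dist x s" if "s \<in> span X" for s
    using that span_subset_closure_rat_closed[OF C(4,3)] span_mono[OF C(2)] by blast
  then have far: "\<epsilon> \<le> infdist x (span X)"
    using span_zero[of X] by (auto simp: infdist_def intro!: cINF_greatest)
  obtain h where h: "\<And>x. blinfun_apply h x \<le> infdist x (span X)"
    "blinfun_apply h x = infdist x (span X)" "norm h \<le> 1"
  proof (rule hahn_banach_blinfun[of "\<lambda>x. infdist x (span X)" 1 x])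
    show "infdist x (span X) \<le> 1 * norm x" for x
      using infdist_le[OF span_zero, of x X] by simp
  qed (auto intro: sublinear_infdist_subspace)
  have h0: "blinfun_apply h a = 0" if "a \<in> X" for a
    using h(1)[of a] h(1)[of "- a"] span_base[OF that] span_neg[OF span_base[OF that]]
    by (simp add: blinfun.minus_right)
  \<comment> \<open>A point \<open>w\<close> of the slice at \<open>v + r h\<close> of depth at most \<open>r \<epsilon> / 2\<close> loses against \<open>x\<close> by less
    than that depth, while \<open>x\<close> is optimal for \<open>v\<close>; hence \<open>h w\<close> is at least \<open>h x - \<epsilon> / 2\<close>.\<close>
  define z' where "z' = v + r *\<^sub>R h"
  define \<delta>' where "\<delta>' = min (\<delta> / 4) (r * \<epsilon> / 2)"
  have \<delta>': "0 < \<delta>'" "\<delta>' \<le> \<delta> / 4" "\<delta>' \<le> r * \<epsilon> / 2" using pos r by (auto simp: \<delta>'_def)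
  have near: "dist z' z \<le> 2 * r"
  proof -
    have "dist z' v \<le> r"
      using h(3) r(1) mult_left_mono[of "norm h" 1 r] by (simp add: z'_def dist_norm)
    then show ?thesis using v(1) dist_triangle[of z' z v] by (simp add: dist_commute)
  qed
  show ?thesis
  proof (rule exI[of _ x], rule exI[of _ h], rule exI[of _ z'], rule exI[of _ \<delta>'], intro conjI)
    have "x \<in> slice v (\<delta> / 2)" using x pos by (simp add: slice_def)
    moreover have "2 * (dist v z * R) \<le> 2 * (r * R)"
      using v(1) R_pos by (simp add: dist_commute)
    then have "slice v (\<delta> / 2) \<subseteq> slice z \<delta>"
      using r by (intro slice_subset_slice) linarith
    ultimately show "x \<in> slice z \<delta>" by blast
    show "cball z' \<delta>' \<subseteq> cball z \<delta>"
    proof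
      fix w assume "w \<in> cball z' \<delta>'"
      then show "w \<in> cball z \<delta>"
        using dist_triangle[of z w z'] near r \<delta>' by (simp add: dist_commute)
    qed
    have "dist z' z * R \<le> 2 * (r * R)" using near R_pos by simp
    then show "slice z' \<delta>' \<subseteq> slice z \<delta>"
      using r \<delta>' by (intro slice_subset_slice) simp
    show "\<forall>w\<in>slice z' \<delta>'. \<epsilon> / 2 \<le> blinfun_apply h w"
    proof
      fix w assume w: "w \<in> slice z' \<delta>'"
      have "F w + blinfun_apply v w \<le> psup (blinfun_apply v)"
        "F x + blinfun_apply z' x \<le> psup (blinfun_apply z')"
        using w x by (auto intro!: psup_upper bdd_blinfun simp: slice_def)
      then have "r * blinfun_apply h x - \<delta>' \<le> r * blinfun_apply h w"
        using w x by (simp add: slice_def z'_def blinfun.add_left blinfun.scaleR_left)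
      moreover have "r * \<epsilon> \<le> r * blinfun_apply h x" using far h(2) r by simp
      ultimately have "r * (\<epsilon> / 2) \<le> r * blinfun_apply h w" using \<delta>' by simp
      then show "\<epsilon> / 2 \<le> blinfun_apply h w" using r by simp
    qed
  qed (use h h0 \<delta>' pos in auto)
qed

text \<open>
  Iterating the step produces the triangular array of James' characterization of weak
  compactness: \<open>h n\<close> vanishes at the earlier points and is bounded away from zero at the later
  ones, so that the two iterated limits of \<open>h n (x m)\<close> cannot agree. At the same time the points are
  maximizing for the limit \<open>y\<close> of the tilted functionals.
\<close>

lemma escaping_sequence:
  assumes V: "open V" "V \<noteq> {}" and att: "\<And>z. z \<in> V \<Longrightarrow> attained z"
    and large: "\<And>z \<eta> q. z \<in> V \<Longrightarrow> 0 < \<eta> \<Longrightarrow> \<not> slice z \<eta> \<subseteq> cball q (2 * \<epsilon>)"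
    and \<epsilon>: "0 < \<epsilon>"
  obtains y x h where "y \<in> V" "\<And>n. x n \<in> D" "(\<lambda>n. F (x n) + blinfun_apply y (x n)) \<longlonglongrightarrow> psup (blinfun_apply y)"
    "\<And>n. norm (h n :: 'a \<Rightarrow>\<^sub>L real) \<le> 1" "\<And>m n. m < n \<Longrightarrow> blinfun_apply (h n) (x m) = 0"
    "\<And>m n. n < m \<Longrightarrow> \<epsilon> / 2 \<le> blinfun_apply (h n) (x m)"
proof -
  obtain z0 \<delta>0 where z0: "0 < \<delta>0" "cball z0 \<delta>0 \<subseteq> V"
    using V open_contains_cball by (metis ex_in_conv)
  \<comment> \<open>A state consists of a functional, a radius that is also the depth of a slice, the finite set of
    points chosen so far, and the last choices of a point and a functional.\<close>
  define inv where "inv = (\<lambda>(z, \<delta>, X, x :: 'a, h :: 'a \<Rightarrow>\<^sub>L real). cball z \<delta> \<subseteq> V \<and> 0 < \<delta> \<and> finite (X :: 'a set))"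
  define step where "step = (\<lambda>(z, \<delta>, X, x :: 'a, h :: 'a \<Rightarrow>\<^sub>L real) (z', \<delta>', X', x', h').
     x' \<in> slice z \<delta> \<and> norm h' \<le> 1 \<and> (\<forall>a\<in>X. blinfun_apply h' a = 0) \<and> \<delta>' \<le> \<delta> / 2 \<and>
     cball z' \<delta>' \<subseteq> cball z \<delta> \<and> slice z' \<delta>' \<subseteq> slice z \<delta> \<and> (\<forall>w\<in>slice z' \<delta>'. \<epsilon> / 2 \<le> blinfun_apply h' w) \<and>
     X' = insert x' X)"
  have "\<exists>s. \<forall>n. inv (s n) \<and> step (s n) (s (Suc n))"
  proof (rule dependent_nat_choice)
    show "\<exists>s. inv s"
      using z0 by (intro exI[of _ "(z0, \<delta>0, {}, undefined, undefined)"]) (simp add: inv_def)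
  next
    fix s and n :: nat assume s: "inv s"
    obtain z \<delta> X xx hh where eq: "s = (z, \<delta>, X, xx, hh)" by (cases s)
    have i: "cball z \<delta> \<subseteq> V" "0 < \<delta>" "finite X" using s by (auto simp: inv_def eq)
    have "\<forall>v\<in>cball z \<delta>. attained v" "\<forall>v\<in>cball z \<delta>. \<forall>\<eta>>0. \<forall>q. \<not> slice v \<eta> \<subseteq> cball q (2 * \<epsilon>)"
      using att large i(1) by blast+
    note next_step = escape_step[OF this \<epsilon> i(2,3)]
    obtain x h z' \<delta>' where st: "x \<in> slice z \<delta>" "norm h \<le> 1" "\<forall>a\<in>X. blinfun_apply h a = 0"
      "0 < \<delta>'" "\<delta>' \<le> \<delta> / 2" "cball z' \<delta>' \<subseteq> cball z \<delta>" "slice z' \<delta>' \<subseteq> slice z \<delta>"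
      "\<forall>w\<in>slice z' \<delta>'. \<epsilon> / 2 \<le> blinfun_apply h w"
      using next_step by (elim exE conjE) (rule that)
    show "\<exists>s'. inv s' \<and> step s s'"
      using st i by (intro exI[of _ "(z', \<delta>', insert x X, x, h)"]) (auto simp: inv_def step_def eq)
  qed
  then obtain s where s: "\<And>n. inv (s n)" "\<And>n. step (s n) (s (Suc n))" by blast
  define z \<delta> X x h where "z n = fst (s n)" and "\<delta> n = fst (snd (s n))" and "X n = fst (snd (snd (s n)))"
    and "x n = fst (snd (snd (snd (s (Suc n)))))" and "h n = snd (snd (snd (snd (s (Suc n)))))" for n
  have inv: "cball (z n) (\<delta> n) \<subseteq> V" "0 < \<delta> n" for n
    using s(1)[of n] by (auto simp: inv_def z_def \<delta>_def split: prod.splits)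
  have step: "x n \<in> slice (z n) (\<delta> n)" "norm (h n) \<le> 1" "\<And>a. a \<in> X n \<Longrightarrow> blinfun_apply (h n) a = 0"
    "\<delta> (Suc n) \<le> \<delta> n / 2" "cball (z (Suc n)) (\<delta> (Suc n)) \<subseteq> cball (z n) (\<delta> n)"
    "slice (z (Suc n)) (\<delta> (Suc n)) \<subseteq> slice (z n) (\<delta> n)"
    "\<And>w. w \<in> slice (z (Suc n)) (\<delta> (Suc n)) \<Longrightarrow> \<epsilon> / 2 \<le> blinfun_apply (h n) w"
    "X (Suc n) = insert (x n) (X n)" for n
    using s(2)[of n] by (auto simp: step_def z_def \<delta>_def X_def x_def h_def split: prod.splits)
  have nest: "cball (z m) (\<delta> m) \<subseteq> cball (z n) (\<delta> n)" "slice (z m) (\<delta> m) \<subseteq> slice (z n) (\<delta> n)"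
    "X n \<subseteq> X m" if "n \<le> m" for m n
    using lift_Suc_antimono_le[of "\<lambda>n. cball (z n) (\<delta> n)", OF step(5) that]
      lift_Suc_antimono_le[of "\<lambda>n. slice (z n) (\<delta> n)", OF step(6) that]
      lift_Suc_mono_le[of X, OF _ that] step(8) by auto
  have "\<delta> n \<le> \<delta> 0 / 2 ^ n" for n
  proof (induction n)
    case (Suc n)
    then have "\<delta> n / 2 \<le> \<delta> 0 / 2 ^ n / 2" by simp
    with step(4)[of n] show ?case by (simp add: mult.commute)
  qed simp
  moreover have "(\<lambda>n. \<delta> 0 / 2 ^ n) \<longlonglongrightarrow> 0" by (intro LIMSEQ_divide_realpow_zero) auto
  ultimately have \<delta>0: "\<delta> \<longlonglongrightarrow> 0"
    using inv(2) by (intro tendsto_sandwich[of "\<lambda>_. 0" \<delta> _ "\<lambda>n. \<delta> 0 / 2 ^ n"])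
      (auto intro!: always_eventually less_imp_le)
  have zin: "z m \<in> cball (z n) (\<delta> n)" if "n \<le> m" for m n
    using nest(1)[OF that] inv(2)[of m] by (meson centre_in_cball less_imp_le subsetD)
  have "Cauchy z"
  proof (rule metric_CauchyI)
    fix e :: real assume "0 < e"
    then obtain N where N: "\<delta> N < e / 2" using \<delta>0 inv(2)
      by (metis LIMSEQ_D abs_of_pos diff_zero half_gt_zero order_refl real_norm_def)
    have "dist (z m) (z n) < e" if "N \<le> m" "N \<le> n" for m n
      using zin[OF that(1)] zin[OF that(2)] N dist_triangle3[of "z m" "z n" "z N"] by simp
    then show "\<exists>N. \<forall>m\<ge>N. \<forall>n\<ge>N. dist (z m) (z n) < e" by blast
  qed
  then obtain y where y: "z \<longlonglongrightarrow> y" using Cauchy_convergent_iff convergent_def by metis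
  have ycb: "y \<in> cball (z n) (\<delta> n)" for n
    using closed_sequentially[OF closed_cball, of "\<lambda>m. z (m + n)"] LIMSEQ_ignore_initial_segment[OF y] zin
    by simp
  have xD: "x n \<in> D" for n using step(1) by (auto simp: slice_def)
  have "(\<lambda>n. F (x n) + blinfun_apply y (x n)) \<longlonglongrightarrow> psup (blinfun_apply y)"
  proof (rule tendsto_sandwich)
    show "\<forall>\<^sub>F n in sequentially. psup (blinfun_apply y) - \<delta> n * (1 + 2 * R) \<le> F (x n) + blinfun_apply y (x n)"
    proof (rule always_eventually, rule allI)
      fix n
      have d: "dist y (z n) * R \<le> \<delta> n * R" using ycb[of n] R_pos by (simp add: dist_commute)
      have "slice (z n) (\<delta> n) \<subseteq> slice y (\<delta> n * (1 + 2 * R))"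
        using d by (intro slice_subset_slice) (simp add: algebra_simps dist_commute)
      then show "psup (blinfun_apply y) - \<delta> n * (1 + 2 * R) \<le> F (x n) + blinfun_apply y (x n)"
        using step(1)[of n] by (auto simp: slice_def)
    qed
    show "\<forall>\<^sub>F n in sequentially. F (x n) + blinfun_apply y (x n) \<le> psup (blinfun_apply y)"
      using xD by (auto intro!: always_eventually psup_upper bdd_blinfun)
    have "(\<lambda>n. psup (blinfun_apply y) - \<delta> n * (1 + 2 * R)) \<longlonglongrightarrow> psup (blinfun_apply y) - 0 * (1 + 2 * R)"
      by (intro tendsto_intros \<delta>0)
    then show "(\<lambda>n. psup (blinfun_apply y) - \<delta> n * (1 + 2 * R)) \<longlonglongrightarrow> psup (blinfun_apply y)" by simp
  qed simp
  moreover have "blinfun_apply (h n) (x m) = 0" if "m < n" for m n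
    using step(3)[of "x m" n] step(8)[of m] nest(3)[of "Suc m" n] that by auto
  moreover have "\<epsilon> / 2 \<le> blinfun_apply (h n) (x m)" if "n < m" for m n
    using step(7)[of "x m" n] step(1)[of m] nest(2)[of "Suc n" m] that by auto
  moreover have "y \<in> V" using ycb inv(1) by blast
  ultimately show ?thesis using xD step(2) by (intro that[of y x h])
qed

end

section \<open>Upper limits of functionals and undetermined subsequences\<close>

text \<open>
  The upper limit of a bounded real sequence as a real number, which avoids passing to extended
  reals and back in every estimate.
\<close>

definition lsup :: "(nat \<Rightarrow> real) \<Rightarrow> real" where
  "lsup s = Inf {a. \<forall>\<^sub>F n in sequentially. s n \<le> a}"

lemma lsup_le:
  assumes "\<And>n. - K \<le> s n" "\<forall>\<^sub>F n in sequentially. s n \<le> a"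
  shows "lsup s \<le> a"
  unfolding lsup_def
proof (rule cInf_lower)
  show "bdd_below {a. \<forall>\<^sub>F n in sequentially. s n \<le> a}"
  proof (rule bdd_belowI[of _ "- K"])
    fix b assume "b \<in> {a. \<forall>\<^sub>F n in sequentially. s n \<le> a}"
    then obtain n where "s n \<le> b" by (auto dest: eventually_happens)
    with assms(1)[of n] show "- K \<le> b" by simp
  qed
qed (use assms in simp)

lemma eventually_less_lsup:
  assumes "\<And>n. s n \<le> K" "lsup s < a"
  shows "\<forall>\<^sub>F n in sequentially. s n < a"
proof -
  have "\<exists>b\<in>{a. \<forall>\<^sub>F n in sequentially. s n \<le> a}. b < a"
    using assms(2) unfolding lsup_def
    by (rule cInf_lessD[rotated]) (use assms(1) in \<open>auto intro!: exI[of _ K] always_eventually\<close>)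
  then show ?thesis by (auto elim: eventually_mono)
qed

text \<open>
  The upper limit of the functionals, taken pointwise on \<open>'a\<close>: a sublinear functional.
  The lower limit at \<open>x\<close> is \<open>- Lsup h (- x)\<close>.
\<close>

definition Lsup :: "(nat \<Rightarrow> 'a::real_normed_vector \<Rightarrow>\<^sub>L real) \<Rightarrow> 'a \<Rightarrow> real" where
  "Lsup h x = lsup (\<lambda>n. blinfun_apply (h n) x)"

locale bounded_functionals =
  fixes h :: "nat \<Rightarrow> 'a::real_normed_vector \<Rightarrow>\<^sub>L real" and K :: real
  assumes norm_h: "norm (h n) \<le> K"
begin

lemma abs_h: "\<bar>blinfun_apply (h n) x\<bar> \<le> K * norm x"
  using norm_blinfun[of "h n" x] norm_h[of n] mult_right_mono[of "norm (h n)" K "norm x"] by simp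

lemma Lsup_le: "\<forall>\<^sub>F n in sequentially. blinfun_apply (h n) x \<le> a \<Longrightarrow> Lsup h x \<le> a"
  unfolding Lsup_def using abs_h[of _ x] by (intro lsup_le[of "K * norm x"]) (auto simp: abs_le_iff minus_le_iff)

lemma eventually_less_Lsup: "Lsup h x < a \<Longrightarrow> \<forall>\<^sub>F n in sequentially. blinfun_apply (h n) x < a"
  unfolding Lsup_def using abs_h[of _ x] by (intro eventually_less_lsup[of _ "K * norm x"]) (auto simp: abs_le_iff)

lemma Lsup_upper: "Lsup h x \<le> K * norm x"
  using abs_h[of _ x] by (intro Lsup_le always_eventually) (auto simp: abs_le_iff)

lemma sublinear_Lsup: "sublinear (Lsup h)"
proof (rule sublinearI_pos)
  fix x y
  show "Lsup h (x + y) \<le> Lsup h x + Lsup h y"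
  proof (rule field_le_epsilon)
    fix e :: real assume "0 < e"
    then have "\<forall>\<^sub>F n in sequentially. blinfun_apply (h n) x < Lsup h x + e / 2"
      "\<forall>\<^sub>F n in sequentially. blinfun_apply (h n) y < Lsup h y + e / 2"
      by (auto intro: eventually_less_Lsup)
    then have "\<forall>\<^sub>F n in sequentially. blinfun_apply (h n) (x + y) \<le> Lsup h x + Lsup h y + e"
      by eventually_elim (simp add: blinfun.add_right)
    then show "Lsup h (x + y) \<le> Lsup h x + Lsup h y + e" by (rule Lsup_le)
  qed
next
  have "0 \<le> Lsup h 0"
  proof (rule ccontr)
    assume "\<not> 0 \<le> Lsup h 0"
    then have "\<forall>\<^sub>F n in sequentially. blinfun_apply (h n) 0 < 0" by (intro eventually_less_Lsup) simp
    then show False by (auto dest: eventually_happens)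
  qed
  then show "Lsup h 0 = 0" using Lsup_upper[of 0] by simp
next
  fix c :: real and x assume c: "0 < c"
  show "Lsup h (c *\<^sub>R x) \<le> c * Lsup h x"
  proof (rule field_le_epsilon)
    fix e :: real assume "0 < e"
    then have "\<forall>\<^sub>F n in sequentially. blinfun_apply (h n) x < Lsup h x + e / c"
      using c by (intro eventually_less_Lsup) simp
    then have "\<forall>\<^sub>F n in sequentially. blinfun_apply (h n) (c *\<^sub>R x) \<le> c * Lsup h x + e"
    proof eventually_elim
      case (elim n)
      then have "c * blinfun_apply (h n) x \<le> c * (Lsup h x + e / c)" using c by simp
      then show ?case using c by (simp add: blinfun.scaleR_right distrib_left)
    qed
    then show "Lsup h (c *\<^sub>R x) \<le> c * Lsup h x + e" by (rule Lsup_le)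
  qed
qed

lemma Lsup_abs: "\<bar>Lsup h x\<bar> \<le> K * norm x"
  using Lsup_upper[of x] Lsup_upper[of "- x"] sublinear_neg[OF sublinear_Lsup, of x] by simp

lemma subseq: "bounded_functionals (h \<circ> r) K"
  by standard (simp add: norm_h)

lemma Lsup_subseq:
  assumes "strict_mono r" shows "Lsup (h \<circ> r) x \<le> Lsup h x"
proof (rule field_le_epsilon)
  fix e :: real assume "0 < e"
  then have "\<forall>\<^sub>F n in sequentially. blinfun_apply (h n) x < Lsup h x + e"
    by (intro eventually_less_Lsup) simp
  from eventually_subseq[OF assms this]
  have "\<forall>\<^sub>F n in sequentially. blinfun_apply ((h \<circ> r) n) x \<le> Lsup h x + e"
    by eventually_elim simp
  then show "Lsup (h \<circ> r) x \<le> Lsup h x + e" by (rule bounded_functionals.Lsup_le[OF subseq])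
qed

lemma Lsup_shift: "Lsup (h \<circ> (+) k) x = Lsup h x"
  by (simp add: Lsup_def lsup_def o_def add.commute[of k]
      eventually_sequentially_seg[where P="\<lambda>n. blinfun_apply (h n) x \<le> _"])

text \<open>
  Along a subsequence on which \<open>h n x\<close> approaches its lower limit, the upper limit at the single
  point \<open>x\<close> drops to the lower limit.
\<close>

lemma ex_subseq_Lsup_neg:
  assumes "0 < e"
  obtains r where "strict_mono r" "Lsup (h \<circ> r) x \<le> e - Lsup h (- x)"
proof -
  have "\<not> (\<forall>\<^sub>F n in sequentially. blinfun_apply (h n) (- x) \<le> Lsup h (- x) - e)"
    using Lsup_le[of "- x" "Lsup h (- x) - e"] assms by auto
  then have "\<exists>\<^sub>F n in sequentially. blinfun_apply (h n) x \<le> e - Lsup h (- x)"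
    unfolding not_eventually by (rule frequently_elim1) (simp add: blinfun.minus_right)
  then have "infinite {n. blinfun_apply (h n) x \<le> e - Lsup h (- x)}"
    by (simp add: cofinite_eq_sequentially[symmetric] frequently_cofinite)
  from infinite_enumerate[OF this] obtain r
    where r: "strict_mono (r :: nat \<Rightarrow> nat)" "\<forall>n. blinfun_apply (h (r n)) x \<le> e - Lsup h (- x)"
    unfolding mem_Collect_eq by blast
  then have "Lsup (h \<circ> r) x \<le> e - Lsup h (- x)"
    by (intro bounded_functionals.Lsup_le[OF subseq] always_eventually) simp
  with r(1) show ?thesis by (rule that)
qed

end

context bounded_payoff begin

text \<open>
  The non-attaining perturbation is a limit of functionals of the form \<open>\<psi> - c l\<close>, where \<open>\<psi>\<close> is built step by step but
  the linear functional \<open>l\<close> can be chosen only at the end. Until then the upper limit \<open>L\<close>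
  takes the place of \<open>l\<close>.
\<close>

definition penalized :: "('a \<Rightarrow> real) \<Rightarrow> ('a \<Rightarrow>\<^sub>L real) \<Rightarrow> real \<Rightarrow> real" where
  "penalized L \<psi> c = psup (\<lambda>x. blinfun_apply \<psi> x - c * L x)"

lemma bdd_penalized:
  assumes "\<And>x. \<bar>L x\<bar> \<le> K * norm x" "0 \<le> K"
  shows "bdd_above ((\<lambda>x. blinfun_apply \<psi> x - c * L x) ` D)"
proof (rule bdd_aboveI)
  fix r assume "r \<in> (\<lambda>x. blinfun_apply \<psi> x - c * L x) ` D"
  then obtain x where x: "x \<in> D" "r = blinfun_apply \<psi> x - c * L x" by auto
  have "\<bar>c * L x\<bar> \<le> \<bar>c\<bar> * (K * R)"
    unfolding abs_mult using assms D_bound[OF x(1)]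
    by (intro mult_left_mono order_trans[OF assms(1)]) auto
  then show "r \<le> norm \<psi> * R + \<bar>c\<bar> * (K * R)" using x blinfun_bound[OF x(1), of \<psi>] by simp
qed

text \<open>
  Pryce's device. The number \<open>penalized (Lsup (h \<circ> r)) \<psi> c\<close> with \<open>c \<ge> 0\<close> can only grow when
  \<open>r\<close> is thinned out. A diagonal sequence makes it, for countably many pairs \<open>(\<psi>, c)\<close> at once, as large as any
  further thinning could. For such a sequence it makes no difference whether the penalty is the upper
  or the lower limit, since for each point \<open>x\<close> a further subsequence turns the lower limit at
  \<open>x\<close> into the upper one. Consequently every linear functional between the two limits gives
  the same supremum.
\<close>

lemma pryce_subsequence:
  assumes h: "bounded_functionals h K" and K: "0 \<le> K"
    and C: "countable C" "countable T" and nonneg: "\<forall>c\<in>T. 0 \<le> c"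
  shows "\<exists>r. strict_mono r \<and> (\<forall>\<psi>\<in>C. \<forall>c\<in>T.
      psup (\<lambda>x. blinfun_apply \<psi> x + c * Lsup (h \<circ> r) (- x)) \<le> penalized (Lsup (h \<circ> r)) \<psi> c)"
proof -
  have T: "0 \<le> c" if "c \<in> T" for c using nonneg that by blast
  interpret h: bounded_functionals h K by fact
  have labs: "\<bar>Lsup (h \<circ> s) x\<bar> \<le> K * norm x" for s x
    by (rule bounded_functionals.Lsup_abs[OF h.subseq])
  define val where "val \<psi> c s = penalized (Lsup (h \<circ> s)) \<psi> c" for \<psi> c and s :: "nat \<Rightarrow> nat"
  have bdd: "bdd_above ((\<lambda>x. blinfun_apply \<psi> x - c * Lsup (h \<circ> s) x) ` D)" for \<psi> c s
    by (rule bdd_penalized[OF labs K])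
  have val_sub: "val \<psi> c s \<le> val \<psi> c (s \<circ> r)" if "strict_mono r" "0 \<le> c" for \<psi> c s r
    using psup_mono[OF bdd[of \<psi> c "s \<circ> r"], of "\<lambda>x. blinfun_apply \<psi> x - c * Lsup (h \<circ> s) x" 0]
      bounded_functionals.Lsup_subseq[OF h.subseq that(1), of s] mult_left_mono[OF _ that(2)]
    by (simp add: val_def penalized_def o_assoc)
  have val_shift: "val \<psi> c (s \<circ> (+) k) = val \<psi> c s" for \<psi> c s k
  proof -
    have "Lsup (h \<circ> (s \<circ> (+) k)) = Lsup (h \<circ> s)"
      using bounded_functionals.Lsup_shift[OF h.subseq, of s k] by (simp add: o_assoc fun_eq_iff)
    then show ?thesis by (simp add: val_def)
  qed
  have val_le: "val \<psi> c s \<le> psup (blinfun_apply \<psi>) + c * (K * R)" if "0 \<le> c" for \<psi> c s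
    unfolding val_def penalized_def
  proof (rule psup_mono[OF bdd_blinfun])
    fix x assume x: "x \<in> D"
    have "- Lsup (h \<circ> s) x \<le> K * R"
      using labs[of s x] mult_left_mono[OF D_bound[OF x] K] by simp
    from mult_left_mono[OF this that]
    show "blinfun_apply \<psi> x - c * Lsup (h \<circ> s) x \<le> blinfun_apply \<psi> x + c * (K * R)" by simp
  qed
  define e where "e = from_nat_into (C \<times> T \<times> (UNIV :: nat set))"
  \<comment> \<open>\<open>P n s\<close>: thinning out \<open>s\<close> further gains at most \<open>1 / (k + 1)\<close> for the \<open>n\<close>-th triple
    \<open>(\<psi>, c, k)\<close>.\<close>
  define P where "P n s \<longleftrightarrow> (case e n of (\<psi>, c, k) \<Rightarrow> 0 \<le> c \<longrightarrow>
     (\<forall>r. strict_mono r \<longrightarrow> val \<psi> c (s \<circ> r) \<le> val \<psi> c s + 1 / Suc k))" for n s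
  interpret subseqs P
  proof
    fix n and s :: "nat \<Rightarrow> nat" assume "strict_mono s"
    obtain \<psi> c k where e: "e n = (\<psi>, c, k)" by (cases "e n")
    show "\<exists>r'. strict_mono r' \<and> P n (s \<circ> r')"
    proof (cases "0 \<le> c")
      case True
      define S where "S = (SUP r\<in>Collect strict_mono. val \<psi> c (s \<circ> r))"
      have ne: "Collect strict_mono \<noteq> ({} :: (nat \<Rightarrow> nat) set)" using strict_mono_id by blast
      have bd: "bdd_above ((\<lambda>r. val \<psi> c (s \<circ> r)) ` Collect strict_mono)"
        using val_le[OF True] by (intro bdd_aboveI2)
      have "S - 1 / Suc k < S" by simp
      then obtain r where r: "strict_mono r" "S - 1 / Suc k < val \<psi> c (s \<circ> r)"
        unfolding S_def less_cSUP_iff[OF ne bd] by auto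
      have "val \<psi> c (s \<circ> r \<circ> r') \<le> val \<psi> c (s \<circ> r) + 1 / Suc k" if "strict_mono r'" for r'
      proof -
        have "val \<psi> c (s \<circ> (r \<circ> r')) \<le> S"
          unfolding S_def by (rule cSUP_upper[OF CollectI[of strict_mono, OF strict_mono_o[OF r(1) that]] bd])
        then show ?thesis using r(2) by (simp add: o_assoc)
      qed
      then show ?thesis using r(1) e by (auto simp: P_def)
    next
      case False
      then show ?thesis using strict_mono_id by (auto simp: P_def e)
    qed
  qed
  have stable: "P n (s \<circ> r)" if r: "strict_mono r" and P: "P n s" for r s n
  proof -
    obtain \<psi> c k where e: "e n = (\<psi>, c, k)" by (cases "e n")
    show ?thesis
      unfolding P_def e prod.case
    proof (intro impI allI)
      fix r' :: "nat \<Rightarrow> nat" assume c: "0 \<le> c" and r': "strict_mono r'"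
      have "val \<psi> c (s \<circ> (r \<circ> r')) \<le> val \<psi> c s + 1 / Suc k"
        using P c strict_mono_o[OF r r'] by (auto simp: P_def e)
      then show "val \<psi> c (s \<circ> r \<circ> r') \<le> val \<psi> c (s \<circ> r) + 1 / Suc k"
        using val_sub[OF r c, of \<psi> s] by (simp add: o_assoc)
    qed
  qed
  define d where "d = diagseq"
  have d: "strict_mono d" "P n (d \<circ> (+) (Suc n))" for n
    using subseq_diagseq diagseq_holds[OF stable] by (auto simp: d_def)
  have max: "val \<psi> c (d \<circ> r) \<le> val \<psi> c d" if r: "strict_mono r" and \<psi>: "\<psi> \<in> C" "c \<in> T" for r \<psi> c
  proof (rule field_le_epsilon)
    fix \<eta> :: real assume "0 < \<eta>"
    then obtain k where k: "1 / Suc k < \<eta>" using nat_approx_posE by metis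
    have "(\<psi>, c, k) \<in> C \<times> T \<times> UNIV" using \<psi> by simp
    then obtain n where n: "e n = (\<psi>, c, k)"
      unfolding e_def using C by (metis countable_SIGMA countableI_type from_nat_into_surj)
    \<comment> \<open>The diagonal sequence is a subsequence of the \<open>n\<close>-th one only from the index \<open>Suc n\<close> on, and
      upper limits ignore the initial segment.\<close>
    define j where "j = Suc n"
    define r' where "r' i = r (j + i) - j" for i
    have jr: "j \<le> r (j + i)" for i using seq_suble[OF r, of "j + i"] by simp
    have r': "strict_mono r'"
    proof (rule strict_monoI)
      fix a b :: nat assume "a < b"
      then have "r (j + a) < r (j + b)" using r by (simp add: strict_mono_less)
      then show "r' a < r' b" using jr[of a] by (simp add: r'_def)
    qed
    have eq: "d \<circ> r \<circ> (+) j = d \<circ> (+) j \<circ> r'" using jr by (simp add: fun_eq_iff r'_def)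
    have "val \<psi> c (d \<circ> r) = val \<psi> c (d \<circ> r \<circ> (+) j)" by (simp add: val_shift)
    also have "\<dots> \<le> val \<psi> c (d \<circ> (+) j) + 1 / Suc k"
      unfolding eq using d(2)[of n] r' T[OF \<psi>(2)] by (auto simp: P_def n j_def)
    also have "\<dots> \<le> val \<psi> c d + \<eta>" using k by (simp add: val_shift)
    finally show "val \<psi> c (d \<circ> r) \<le> val \<psi> c d + \<eta>" .
  qed
  have "psup (\<lambda>x. blinfun_apply \<psi> x + c * Lsup (h \<circ> d) (- x)) \<le> penalized (Lsup (h \<circ> d)) \<psi> c"
    if \<psi>: "\<psi> \<in> C" "c \<in> T" for \<psi> c
  proof (rule psup_least)
    fix x assume x: "x \<in> D"
    show "F x + (blinfun_apply \<psi> x + c * Lsup (h \<circ> d) (- x)) \<le> penalized (Lsup (h \<circ> d)) \<psi> c"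
    proof (rule field_le_epsilon)
      fix \<eta> :: real assume \<eta>: "0 < \<eta>"
      define e where "e = \<eta> / (c + 1)"
      have e: "0 < e" "c * e \<le> \<eta>" using \<eta> T[OF \<psi>(2)] by (auto simp: e_def field_simps)
      obtain r where r: "strict_mono r" "Lsup (h \<circ> d \<circ> r) x \<le> e - Lsup (h \<circ> d) (- x)"
        using bounded_functionals.ex_subseq_Lsup_neg[OF h.subseq e(1)] by metis
      have "F x + (blinfun_apply \<psi> x - c * Lsup (h \<circ> (d \<circ> r)) x) \<le> val \<psi> c (d \<circ> r)"
        unfolding val_def penalized_def by (intro psup_upper[OF bdd x])
      also have "\<dots> \<le> val \<psi> c d" by (rule max[OF r(1) \<psi>])
      finally have "F x + (blinfun_apply \<psi> x - c * Lsup (h \<circ> d \<circ> r) x) \<le> penalized (Lsup (h \<circ> d)) \<psi> c"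
        by (simp add: val_def o_assoc)
      moreover have "c * Lsup (h \<circ> d \<circ> r) x \<le> c * e - c * Lsup (h \<circ> d) (- x)"
        using mult_left_mono[OF r(2) T[OF \<psi>(2)]] by (simp add: algebra_simps)
      ultimately show "F x + (blinfun_apply \<psi> x + c * Lsup (h \<circ> d) (- x)) \<le> penalized (Lsup (h \<circ> d)) \<psi> c + \<eta>"
        using e by simp
    qed
  qed
  then show ?thesis using d(1) by blast
qed

end

section \<open>A perturbation that is not attained\<close>

context bounded_payoff begin

lemma penalized_convex:
  assumes L: "\<And>x. \<bar>L x\<bar> \<le> K * norm x" "0 \<le> K" and st: "0 \<le> s" "0 \<le> t" "s + t = 1"
  shows "penalized L (s *\<^sub>R \<psi> + t *\<^sub>R \<psi>') (s * c + t * c') \<le> s * penalized L \<psi> c + t * penalized L \<psi>' c'"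
proof -
  have "(\<lambda>x. blinfun_apply (s *\<^sub>R \<psi> + t *\<^sub>R \<psi>') x - (s * c + t * c') * L x) =
    (\<lambda>x. s * (blinfun_apply \<psi> x - c * L x) + t * (blinfun_apply \<psi>' x - c' * L x))"
    by (simp add: fun_eq_iff blinfun.add_left blinfun.scaleR_left algebra_simps)
  then show ?thesis
    unfolding penalized_def using psup_convex[OF bdd_penalized[OF L] bdd_penalized[OF L] st] by simp
qed

text \<open>
  The selection step of James' argument. Among the directions in \<open>G\<close>, choose \<open>a\<close> so that the
  penalized supremum is nearly least. For a later direction \<open>g\<close>, the point reached by the mixture
  of \<open>a\<close> and \<open>g\<close> is a convex combination of the starting point \<open>\<psi>\<close> and of the point reached by
  both steps. As the mixture cannot fall below the infimum, convexity turns the gain of the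
  first step into a proportional gain of the second. The weights of the mixture belong to step
  lengths with ratio \<open>q\<close>, and are rational if \<open>q\<close> is.
\<close>

lemma increments_step:
  fixes q \<beta> c \<theta> \<sigma> :: real
  assumes L: "\<And>x. \<bar>L x\<bar> \<le> K * norm x" "0 \<le> K"
    and pos: "0 < q" "0 < \<beta>" "0 < \<sigma>" and ne: "G \<noteq> {}"
    and mix: "\<forall>a\<in>G. \<forall>g\<in>G'. (1 / (1 + q)) *\<^sub>R a + (q / (1 + q)) *\<^sub>R g \<in> G"
    and gap: "\<forall>g\<in>G. penalized L \<psi> c + \<beta> * \<theta> + \<sigma> \<le> penalized L (\<psi> + \<beta> *\<^sub>R g) (c + \<beta>)"
  shows "\<exists>a\<in>G. \<exists>\<sigma>'>0. \<forall>g\<in>G'. penalized L (\<psi> + \<beta> *\<^sub>R a) (c + \<beta>) + (q * \<beta>) * \<theta> + \<sigma>' \<le>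
      penalized L (\<psi> + \<beta> *\<^sub>R a + (q * \<beta>) *\<^sub>R g) (c + \<beta> + q * \<beta>)"
proof -
  let ?N = "penalized L"
  define I where "I = (INF g\<in>G. ?N (\<psi> + \<beta> *\<^sub>R g) (c + \<beta>))"
  have bdd: "bdd_below ((\<lambda>g. ?N (\<psi> + \<beta> *\<^sub>R g) (c + \<beta>)) ` G)"
    by (rule bdd_belowI2) (rule gap[rule_format])
  have I_le: "I \<le> ?N (\<psi> + \<beta> *\<^sub>R g) (c + \<beta>)" if "g \<in> G" for g
    unfolding I_def using that by (intro cINF_lower bdd)
  have I_ge: "?N \<psi> c + \<beta> * \<theta> + \<sigma> \<le> I"
    unfolding I_def by (rule cINF_greatest[OF ne]) (rule gap[rule_format])
  define \<tau> where "\<tau> = q * \<sigma> / 2"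
  have \<tau>: "0 < \<tau>" using pos by (simp add: \<tau>_def)
  then have "I < I + \<tau>" by simp
  then obtain a where a: "a \<in> G" "?N (\<psi> + \<beta> *\<^sub>R a) (c + \<beta>) < I + \<tau>"
    unfolding I_def cINF_less_iff[OF ne bdd] by auto
  have "?N (\<psi> + \<beta> *\<^sub>R a) (c + \<beta>) + (q * \<beta>) * \<theta> + \<tau> \<le> ?N (\<psi> + \<beta> *\<^sub>R a + (q * \<beta>) *\<^sub>R g) (c + \<beta> + q * \<beta>)"
    (is "_ \<le> ?rhs") if g: "g \<in> G'" for g
  proof -
    define s t where "s = 1 / (1 + q)" and "t = q / (1 + q)"
    have st: "0 \<le> s" "0 \<le> t" "s + t = 1" "t = s * q" using pos by (auto simp: s_def t_def field_simps)
    have s1: "s * (1 + q) = 1" using pos by (simp add: s_def)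
    have "\<psi> + \<beta> *\<^sub>R (s *\<^sub>R a + t *\<^sub>R g) = s *\<^sub>R (\<psi> + \<beta> *\<^sub>R a + (q * \<beta>) *\<^sub>R g) + t *\<^sub>R \<psi>"
    proof -
      have "\<psi> = s *\<^sub>R \<psi> + t *\<^sub>R \<psi>" using st(3) by (simp flip: scaleR_add_left)
      then show ?thesis by (simp add: st(4) algebra_simps)
    qed
    moreover have "c + \<beta> = s * (c + \<beta> + q * \<beta>) + t * c"
    proof -
      have "s * (c + \<beta> + q * \<beta>) + t * c = (s + t) * c + s * (1 + q) * \<beta>" by (simp add: algebra_simps)
      then show ?thesis using st(3) s1 by simp
    qed
    ultimately have "I \<le> s * ?rhs + t * ?N \<psi> c"
      using I_le[OF mix[rule_format, OF a(1) g]] penalized_convex[OF L st(1-3), of "\<psi> + \<beta> *\<^sub>R a + (q * \<beta>) *\<^sub>R g" \<psi> "c + \<beta> + q * \<beta>" c]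
      by (simp add: s_def t_def)
    then have "(1 + q) * I \<le> (1 + q) * (s * ?rhs + t * ?N \<psi> c)" using pos by (intro mult_left_mono) auto
    also have "\<dots> = (s * (1 + q)) * (?rhs + q * ?N \<psi> c)" by (simp add: st(4) algebra_simps)
    also have "\<dots> = ?rhs + q * ?N \<psi> c" by (simp only: s1 mult_1)
    finally have "I + q * (I - ?N \<psi> c) \<le> ?rhs" by (simp add: algebra_simps)
    moreover have "q * (\<beta> * \<theta> + \<sigma>) \<le> q * (I - ?N \<psi> c)" using I_ge pos by (intro mult_left_mono) auto
    ultimately show ?thesis using a(2) by (simp add: \<tau>_def algebra_simps)
  qed
  then show ?thesis using a(1) \<tau> by blast
qed

text \<open>
  Iteration of the selection step with the step lengths \<open>q ^ n\<close>. The gain \<open>2 * \<theta>\<close> at the start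
  leaves the room \<open>\<theta>\<close> from which the slack \<open>\<sigma>\<close> of all steps is taken.
\<close>

lemma increments:
  assumes L: "\<And>x. \<bar>L x\<bar> \<le> K * norm x" "0 \<le> K" and q: "0 < q" and \<theta>: "0 < \<theta>"
    and ne: "\<And>n. G n \<noteq> {}"
    and mix: "\<And>n. \<forall>a\<in>G n. \<forall>g\<in>G (Suc n). (1 / (1 + q)) *\<^sub>R a + (q / (1 + q)) *\<^sub>R g \<in> G n"
    and base: "\<forall>g\<in>G 0. penalized L 0 0 + 2 * \<theta> \<le> penalized L g 1"
  shows "\<exists>g. (\<forall>n. g n \<in> G n) \<and>
    (\<forall>n. penalized L (\<Sum>i<n. q ^ i *\<^sub>R g i) (\<Sum>i<n. q ^ i) + q ^ n * \<theta> \<le>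
       penalized L (\<Sum>i<Suc n. q ^ i *\<^sub>R g i) (\<Sum>i<Suc n. q ^ i))"
proof -
  let ?S = "\<lambda>n. \<Sum>i<n. q ^ i"
  define ok where "ok n \<psi> \<longleftrightarrow> (n = 0 \<longrightarrow> \<psi> = 0) \<and> (\<exists>\<sigma>>0. \<forall>g\<in>G n. penalized L \<psi> (?S n) + q ^ n * \<theta> + \<sigma> \<le>
      penalized L (\<psi> + q ^ n *\<^sub>R g) (?S n + q ^ n))" for n \<psi>
  have "\<exists>f. \<forall>n. ok n (f n) \<and> (\<exists>g\<in>G n. f (Suc n) = f n + q ^ n *\<^sub>R g)"
  proof (rule dependent_nat_choice)
    have "penalized L 0 (?S 0) + q ^ 0 * \<theta> + \<theta> \<le> penalized L (0 + q ^ 0 *\<^sub>R g) (?S 0 + q ^ 0)"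
      if "g \<in> G 0" for g
      using base[rule_format, OF that] by simp
    then have "ok 0 0" using \<theta> unfolding ok_def by (intro conjI impI refl exI[of _ \<theta>] ballI)
    then show "\<exists>\<psi>. ok 0 \<psi>" ..
  next
    fix \<psi> n assume "ok n \<psi>"
    then obtain \<sigma> where \<sigma>: "0 < \<sigma>" and gap: "\<forall>g\<in>G n. penalized L \<psi> (?S n) + q ^ n * \<theta> + \<sigma> \<le>
      penalized L (\<psi> + q ^ n *\<^sub>R g) (?S n + q ^ n)" by (auto simp: ok_def)
    have qn: "0 < q ^ n" using q by simp
    note next_gap = increments_step[OF L q qn \<sigma> ne mix gap]
    then obtain a \<sigma>' where a: "a \<in> G n" "0 < \<sigma>'"
      "\<And>g. g \<in> G (Suc n) \<Longrightarrow> penalized L (\<psi> + q ^ n *\<^sub>R a) (?S n + q ^ n) + (q * q ^ n) * \<theta> + \<sigma>' \<le>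
         penalized L (\<psi> + q ^ n *\<^sub>R a + (q * q ^ n) *\<^sub>R g) (?S n + q ^ n + q * q ^ n)"
      by blast
    then have "ok (Suc n) (\<psi> + q ^ n *\<^sub>R a)" by (auto simp: ok_def)
    with a(1) show "\<exists>\<psi>'. ok (Suc n) \<psi>' \<and> (\<exists>g\<in>G n. \<psi>' = \<psi> + q ^ n *\<^sub>R g)" by blast
  qed
  then obtain f where f: "\<And>n. ok n (f n)" "\<And>n. \<exists>g\<in>G n. f (Suc n) = f n + q ^ n *\<^sub>R g" by blast
  then obtain g where g: "\<And>n. g n \<in> G n" "\<And>n. f (Suc n) = f n + q ^ n *\<^sub>R g n" by metis
  have fsum: "f n = (\<Sum>i<n. q ^ i *\<^sub>R g i)" for n
    by (induction n) (use f(1)[of 0] g(2) in \<open>auto simp: ok_def\<close>)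
  have "penalized L (f n) (?S n) + q ^ n * \<theta> \<le> penalized L (f (Suc n)) (?S (Suc n))" for n
  proof -
    obtain \<sigma> where "0 < \<sigma>" "penalized L (f n) (?S n) + q ^ n * \<theta> + \<sigma> \<le> penalized L (f n + q ^ n *\<^sub>R g n) (?S n + q ^ n)"
      using f(1)[of n] g(1)[of n] by (auto simp: ok_def)
    then show ?thesis by (simp add: g(2))
  qed
  then show ?thesis using g(1) unfolding fsum by blast
qed

text \<open>
  A version of James' theorem with a payoff \<open>F\<close>. Pass to a subsequence \<open>k\<close> of \<open>h\<close> as given by
  \<open>pryce_subsequence\<close>, with upper limit \<open>L\<close>. Along the points \<open>x m\<close>, where \<open>L\<close> is at most
  zero, every convex combination \<open>g\<close> of the \<open>k n\<close> is eventually at least \<open>\<theta>\<close>; this is the gain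
  with which \<open>increments\<close> starts. Let \<open>g n\<close> be the resulting convex combinations of late members of
  \<open>k\<close>, and let \<open>l\<close> be a linear functional below their upper limit. It lies between the lower and
  the upper limit of \<open>k\<close>, so that the partial sums of \<open>\<phi> = (\<Sum>i. q ^ i *\<^sub>R (g i - l))\<close> have the same
  suprema as the penalized ones. If \<open>\<phi>\<close> were attained at \<open>x0\<close>, each increment would have to be
  realized at \<open>x0\<close>, up to a tail that is small compared with \<open>q ^ n\<close>. Then all \<open>g n x0\<close>
  would exceed \<open>l x0\<close> by a fixed amount, although \<open>l x0\<close> is at least their lower limit.
\<close>

lemma james_nonattaining:
  fixes h :: "nat \<Rightarrow> 'a \<Rightarrow>\<^sub>L real"
  assumes h: "\<And>n. norm (h n) \<le> K" and K: "0 < K" and \<theta>: "0 < \<theta>"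
    and x: "\<And>n. x n \<in> D" "(\<lambda>n. F (x n)) \<longlonglongrightarrow> psup (\<lambda>_. 0)"
    and zero: "\<And>m n. m < n \<Longrightarrow> blinfun_apply (h n) (x m) = 0"
    and big: "\<And>m n. n < m \<Longrightarrow> \<theta> \<le> blinfun_apply (h n) (x m)"
  shows "\<exists>\<phi>. norm \<phi> \<le> 4 * K \<and> \<not> attained \<phi>"
proof -
  obtain C where C: "countable C" "range h \<subseteq> C" "0 \<in> C" "rat_closed C"
    by (rule ex_countable_rat_closed[of "range h"]) auto
  \<comment> \<open>Rational, as \<open>C\<close> is closed under rational combinations only, and so small that the tail of the
    series behind the term \<open>n\<close> is a small multiple of \<open>q ^ n * \<theta>\<close>.\<close>
  define q where "q = 1 / real (Suc (Suc (nat \<lceil>32 * K * R / \<theta>\<rceil>)))"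
  have q: "0 < q" "q \<le> 1 / 2" "q \<in> \<rat>" "8 * K * R * q \<le> \<theta> / 4"
  proof -
    have "32 * K * R / \<theta> \<le> real (Suc (Suc (nat \<lceil>32 * K * R / \<theta>\<rceil>)))" by linarith
    then show "8 * K * R * q \<le> \<theta> / 4" using \<theta> by (simp add: q_def field_simps)
  qed (auto simp: q_def)
  define S where "S n = (\<Sum>i<n. q ^ i)" for n
  have S0: "0 \<le> S n" for n using q(1) by (auto simp: S_def intro: sum_nonneg)
  have bfh: "bounded_functionals h K" by standard (rule h)
  have "countable (range S)" "\<forall>c\<in>range S. 0 \<le> c" using S0 by auto
  from pryce_subsequence[OF bfh less_imp_le[OF K] C(1) this]
  obtain r where r: "strict_mono r" and undet: "\<forall>\<psi>\<in>C. \<forall>c\<in>range S.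
      psup (\<lambda>x. blinfun_apply \<psi> x + c * Lsup (h \<circ> r) (- x)) \<le> penalized (Lsup (h \<circ> r)) \<psi> c"
    by (elim exE conjE)
  define k where "k = h \<circ> r"
  define L where "L = Lsup k"
  interpret k: bounded_functionals k K unfolding k_def by (rule bounded_functionals.subseq[OF bfh])
  have labs: "\<bar>L x\<bar> \<le> K * norm x" for x unfolding L_def by (rule k.Lsup_abs)
  define G where "G n = convex hull (k ` {n..}) \<inter> C" for n
  have kC: "k n \<in> C" for n using C(2) by (auto simp: k_def)
  have G_ne: "G n \<noteq> {}" for n
    using kC[of n] hull_inc[of "k n" "k ` {n..}" convex] by (auto simp: G_def)
  have mix: "\<forall>a\<in>G n. \<forall>g\<in>G (Suc n). (1 / (1 + q)) *\<^sub>R a + (q / (1 + q)) *\<^sub>R g \<in> G n" for n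
  proof (intro ballI)
    fix a g assume ag: "a \<in> G n" "g \<in> G (Suc n)"
    have "g \<in> convex hull (k ` {n..})"
      using ag(2) hull_mono[of "k ` {Suc n..}" "k ` {n..}" convex, OF image_mono]
      by (auto simp: G_def)
    moreover have "1 / (1 + q) + q / (1 + q) = 1" using q(1) by (simp add: field_simps)
    ultimately show "(1 / (1 + q)) *\<^sub>R a + (q / (1 + q)) *\<^sub>R g \<in> G n"
      using ag q by (auto simp: G_def intro!: convexD[OF convex_convex_hull] rat_closed_scale_add[OF C(4)])
  qed
  have hull_le: "blinfun_apply g x \<le> a" if g: "g \<in> convex hull (k ` {n..})" and a: "\<And>m. n \<le> m \<Longrightarrow> blinfun_apply (k m) x \<le> a" for g n x a
  proof -
    have "convex {g. blinfun_apply g x \<le> a}"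
      by (rule convexI) (auto simp: blinfun.add_left blinfun.scaleR_left intro: convex_bound_le)
    then show ?thesis using hull_minimal[of "k ` {n..}" "{g. blinfun_apply g x \<le> a}" convex] g a by auto
  qed
  have base: "\<forall>g\<in>G 0. penalized L 0 0 + 2 * (\<theta> / 2) \<le> penalized L g 1"
  proof
    fix g assume g: "g \<in> G 0"
    define B where "B = {g. \<exists>N. \<forall>m\<ge>N. \<theta> \<le> blinfun_apply g (x (r m))}"
    have "convex B"
    proof (rule convexI)
      fix a b and u v :: real assume "a \<in> B" "b \<in> B" and uv: "0 \<le> u" "0 \<le> v" "u + v = 1"
      then obtain N N' where N: "\<And>m. N \<le> m \<Longrightarrow> \<theta> \<le> blinfun_apply a (x (r m))"
        "\<And>m. N' \<le> m \<Longrightarrow> \<theta> \<le> blinfun_apply b (x (r m))" by (auto simp: B_def)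
      have "\<theta> \<le> blinfun_apply (u *\<^sub>R a + v *\<^sub>R b) (x (r m))" if "max N N' \<le> m" for m
      proof -
        have "u * \<theta> + v * \<theta> \<le> u * blinfun_apply a (x (r m)) + v * blinfun_apply b (x (r m))"
          using N that uv by (intro add_mono mult_left_mono) auto
        then show ?thesis using uv(3) by (simp add: blinfun.add_left blinfun.scaleR_left flip: distrib_right)
      qed
      then show "u *\<^sub>R a + v *\<^sub>R b \<in> B" unfolding B_def by blast
    qed
    moreover have "range k \<subseteq> B"
    proof (rule image_subsetI)
      fix n
      have "\<theta> \<le> blinfun_apply (k n) (x (r m))" if "Suc n \<le> m" for m
        using big strict_monoD[OF r, of n m] that by (simp add: k_def)
      then show "k n \<in> B" unfolding B_def by blast
    qed
    ultimately have "convex hull (range k) \<subseteq> B" by (intro hull_minimal)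
    moreover have "g \<in> convex hull (range k)" using g by (simp add: G_def atLeast_0)
    ultimately obtain N where N: "\<And>m. N \<le> m \<Longrightarrow> \<theta> \<le> blinfun_apply g (x (r m))" unfolding B_def by blast
    have Lx: "L (x (r m)) \<le> 0" for m
      unfolding L_def
    proof (rule k.Lsup_le)
      show "\<forall>\<^sub>F n in sequentially. blinfun_apply (k n) (x (r m)) \<le> 0"
        using zero r by (auto simp: k_def strict_mono_less intro!: eventually_sequentiallyI[of "Suc m"])
    qed
    have "(\<lambda>m. F (x (r m)) + \<theta>) \<longlonglongrightarrow> psup (\<lambda>_. 0) + \<theta>"
      using LIMSEQ_subseq_LIMSEQ[OF x(2) r] by (intro tendsto_intros) (simp add: o_def)
    then have "psup (\<lambda>_. 0) + \<theta> \<le> penalized L g 1"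
    proof (rule LIMSEQ_le_const2, intro exI[of _ N] allI impI)
      fix m assume "N \<le> m"
      then have "F (x (r m)) + \<theta> \<le> F (x (r m)) + (blinfun_apply g (x (r m)) - 1 * L (x (r m)))"
        using N Lx[of m] by force
      also have "\<dots> \<le> penalized L g 1"
        unfolding penalized_def using K by (intro psup_upper bdd_penalized[OF labs] x(1)) simp
      finally show "F (x (r m)) + \<theta> \<le> penalized L g 1" .
    qed
    then show "penalized L 0 0 + 2 * (\<theta> / 2) \<le> penalized L g 1" by (simp add: penalized_def)
  qed
  have "0 \<le> K" "0 < \<theta> / 2" using K \<theta> by auto
  from increments[OF labs this(1) q(1) this(2) G_ne mix base]
  obtain g where g: "\<forall>n. g n \<in> G n"
    and incr: "\<forall>n. penalized L (\<Sum>i<n. q ^ i *\<^sub>R g i) (S n) + q ^ n * (\<theta> / 2) \<le>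
       penalized L (\<Sum>i<Suc n. q ^ i *\<^sub>R g i) (S (Suc n))"
    unfolding S_def by (elim exE conjE)
  have norm_g: "norm (g n) \<le> K" for n
  proof -
    have "convex hull (k ` {n..}) \<subseteq> cball 0 K" using k.norm_h by (intro hull_minimal) auto
    then show ?thesis using g[rule_format, of n] by (auto simp: G_def)
  qed
  interpret g: bounded_functionals g K by standard (rule norm_g)
  obtain l where l: "\<And>x. blinfun_apply l x \<le> Lsup g x" "norm l \<le> K"
    using hahn_banach_blinfun[OF g.sublinear_Lsup g.Lsup_upper less_imp_le[OF K], of 0] by blast
  have g_le: "Lsup g x \<le> L x" for x
  proof (rule field_le_epsilon)
    fix e :: real assume "0 < e"
    then have "\<forall>\<^sub>F n in sequentially. blinfun_apply (k n) x < L x + e"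
      unfolding L_def by (intro k.eventually_less_Lsup) simp
    then obtain N where "\<And>n. N \<le> n \<Longrightarrow> blinfun_apply (k n) x < L x + e"
      by (auto simp: eventually_sequentially)
    then have "blinfun_apply (g n) x \<le> L x + e" if "N \<le> n" for n
      using g[rule_format, of n] that by (intro hull_le[of "g n" n]) (auto simp: G_def less_imp_le)
    then show "Lsup g x \<le> L x + e" by (intro g.Lsup_le eventually_sequentiallyI[of N])
  qed
  have l_le: "blinfun_apply l x \<le> L x" for x using l(1) g_le order_trans by blast
  define v where "v n = (\<Sum>i<n. q ^ i *\<^sub>R (g i - l))" for n
  have v_apply: "blinfun_apply (v n) x = blinfun_apply (\<Sum>i<n. q ^ i *\<^sub>R g i) x - S n * blinfun_apply l x" for n x
    by (simp add: v_def S_def scaleR_diff_right sum_subtractf blinfun.diff_left blinfun.scaleR_left flip: scaleR_sum_left)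
  have fC: "(\<Sum>i<n. q ^ i *\<^sub>R g i) \<in> C" for n
  proof (induction n)
    case (Suc n)
    then show ?case
      using rat_closed_scale_add[OF C(4) Suc _ Rats_1, of "g n" "q ^ n"] g[rule_format, of n] q(3) by (simp add: G_def)
  qed (simp add: C(3))
  have v_eq: "psup (blinfun_apply (v n)) = penalized L (\<Sum>i<n. q ^ i *\<^sub>R g i) (S n)" for n
  proof (rule antisym)
    have "psup (blinfun_apply (v n)) \<le> psup (\<lambda>x. blinfun_apply (\<Sum>i<n. q ^ i *\<^sub>R g i) x + S n * L (- x)) + 0"
    proof (rule psup_mono)
      show "bdd_above ((\<lambda>x. blinfun_apply (\<Sum>i<n. q ^ i *\<^sub>R g i) x + S n * L (- x)) ` D)"
        using bdd_penalized[of "\<lambda>x. - L (- x)" K "\<Sum>i<n. q ^ i *\<^sub>R g i" "S n"] labs[of "- _"] K by simp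
      fix x
      show "blinfun_apply (v n) x \<le> blinfun_apply (\<Sum>i<n. q ^ i *\<^sub>R g i) x + S n * L (- x) + 0"
        using mult_left_mono[OF l_le[of "- x"] S0[of n]] by (simp add: v_apply blinfun.minus_right)
    qed
    also have "\<dots> \<le> penalized L (\<Sum>i<n. q ^ i *\<^sub>R g i) (S n)"
      using undet[rule_format, OF fC rangeI, of n n] by (simp add: L_def k_def)
    finally show "psup (blinfun_apply (v n)) \<le> penalized L (\<Sum>i<n. q ^ i *\<^sub>R g i) (S n)" .
    have "penalized L (\<Sum>i<n. q ^ i *\<^sub>R g i) (S n) \<le> psup (blinfun_apply (v n)) + 0"
      unfolding penalized_def using mult_left_mono[OF l_le S0]
      by (intro psup_mono bdd_blinfun) (simp add: v_apply)
    then show "penalized L (\<Sum>i<n. q ^ i *\<^sub>R g i) (S n) \<le> psup (blinfun_apply (v n))" by simp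
  qed
  define w where "w i = q ^ i *\<^sub>R (g i - l)" for i
  have w: "norm (w i) \<le> q ^ i * (2 * K)" for i
    using norm_triangle_ineq4[of "g i" l] norm_g[of i] l(2) q(1) by (simp add: w_def)
  have geo: "summable (\<lambda>i. q ^ i * (2 * K))" "(\<Sum>i. q ^ i * (2 * K)) \<le> 4 * K"
  proof -
    have "summable (\<lambda>i. q ^ i)" "(\<Sum>i. q ^ i) = 1 / (1 - q)"
      using q by (auto intro!: summable_geometric suminf_geometric)
    moreover have "1 / (1 - q) * (2 * K) \<le> 2 * (2 * K)"
      using q K by (intro mult_right_mono) (auto simp: field_simps)
    ultimately show "summable (\<lambda>i. q ^ i * (2 * K))" "(\<Sum>i. q ^ i * (2 * K)) \<le> 4 * K"
      using K by (auto intro: summable_mult2 simp flip: suminf_mult2)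
  qed
  have sw: "summable w"
    using w by (intro summable_comparison_test'[OF geo(1)])
  define \<phi> where "\<phi> = suminf w"
  have tail: "norm (\<phi> - v n) \<le> q ^ n * (4 * K)" for n
  proof -
    have "\<phi> - v n = (\<Sum>i. w (i + n))"
      using suminf_minus_initial_segment[OF sw, of n]
      unfolding \<phi>_def v_def w_def[symmetric] by simp
    also have "norm \<dots> \<le> (\<Sum>i. q ^ n * (q ^ i * (2 * K)))"
      using w[of "_ + n"] geo(1) by (intro norm_suminf_le summable_mult) (simp add: power_add algebra_simps)
    also have "\<dots> = q ^ n * (\<Sum>i. q ^ i * (2 * K))" using geo(1) by (rule suminf_mult)
    also have "\<dots> \<le> q ^ n * (4 * K)" using geo(2) q(1) by (intro mult_left_mono) auto
    finally show ?thesis .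
  qed
  have "\<not> attained \<phi>"
  proof
    assume "attained \<phi>"
    then obtain x0 where x0: "x0 \<in> D" "F x0 + blinfun_apply \<phi> x0 = psup (blinfun_apply \<phi>)"
      by (auto simp: attained_def)
    have gain: "\<theta> / 4 \<le> blinfun_apply (g n) x0 - blinfun_apply l x0" for n
    proof -
      have "psup (blinfun_apply (v n)) + q ^ n * (\<theta> / 2) \<le> psup (blinfun_apply (v (Suc n)))"
        using incr[rule_format, of n] by (simp only: v_eq)
      also have "\<dots> \<le> psup (blinfun_apply \<phi>) + dist (v (Suc n)) \<phi> * R" by (rule psup_lipschitz)
      also have "psup (blinfun_apply \<phi>) = F x0 + blinfun_apply (v (Suc n)) x0 + blinfun_apply (\<phi> - v (Suc n)) x0"
        using x0(2) by (simp add: blinfun.diff_left)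
      also have "blinfun_apply (\<phi> - v (Suc n)) x0 \<le> norm (\<phi> - v (Suc n)) * R"
        using blinfun_bound[OF x0(1), of "\<phi> - v (Suc n)"] by simp
      also have "dist (v (Suc n)) \<phi> = norm (\<phi> - v (Suc n))" by (simp add: dist_norm norm_minus_commute)
      also have "blinfun_apply (v (Suc n)) x0 = blinfun_apply (v n) x0 + q ^ n * (blinfun_apply (g n) x0 - blinfun_apply l x0)"
        by (simp add: v_def blinfun.add_left blinfun.scaleR_left blinfun.diff_left)
      finally have "q ^ n * (\<theta> / 2) \<le> q ^ n * (blinfun_apply (g n) x0 - blinfun_apply l x0) + 2 * (norm (\<phi> - v (Suc n)) * R)"
        using psup_upper[OF bdd_blinfun x0(1), of "v n"] by (simp add: algebra_simps)
      also have "norm (\<phi> - v (Suc n)) * R \<le> q ^ Suc n * (4 * K) * R"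
        using tail[of "Suc n"] R_pos by (intro mult_right_mono) auto
      also have "q ^ Suc n * (4 * K) * R = q ^ n * (4 * K * R * q)" by (simp add: algebra_simps)
      finally have "q ^ n * (\<theta> / 2) \<le> q ^ n * (blinfun_apply (g n) x0 - blinfun_apply l x0 + 8 * K * R * q)"
        by (simp add: algebra_simps)
      then have "\<theta> / 2 \<le> blinfun_apply (g n) x0 - blinfun_apply l x0 + 8 * K * R * q" using q(1) by simp
      then show ?thesis using q(4) by simp
    qed
    have "Lsup g (- x0) \<le> blinfun_apply l (- x0) - \<theta> / 4"
    proof (rule g.Lsup_le, rule always_eventually, rule allI)
      fix n
      show "blinfun_apply (g n) (- x0) \<le> blinfun_apply l (- x0) - \<theta> / 4"
        using gain[of n] by (simp add: blinfun.minus_right)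
    qed
    then have "\<theta> / 4 \<le> 0" using l(1)[of "- x0"] by simp
    with \<theta> show False by simp
  qed
  then show ?thesis using tail[of 0] by (intro exI[of _ \<phi>]) (simp add: v_def)
qed

end

section \<open>Small slices on a dense open set\<close>

context bounded_payoff begin

text \<open>
  Otherwise the escaping sequence at some \<open>y \<in> V\<close>, with its functionals scaled down so that
  \<open>y + \<phi>\<close> remains in \<open>V\<close>, yields a functional in \<open>V\<close> that is not attained.
\<close>

lemma ex_small_slice:
  assumes V: "open V" "V \<noteq> {}" and att: "\<And>z. z \<in> V \<Longrightarrow> attained z" and \<epsilon>: "0 < \<epsilon>"
  shows "\<exists>z\<in>V. \<exists>\<eta>>0. \<exists>q. slice z \<eta> \<subseteq> cball q \<epsilon>"
proof (rule ccontr)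
  assume "\<not> ?thesis"
  then have large: "\<not> slice z \<eta> \<subseteq> cball q (2 * (\<epsilon> / 2))" if "z \<in> V" "0 < \<eta>" for z \<eta> q
    using that by auto
  obtain y x h where y: "y \<in> V" and x: "\<And>n. x n \<in> D"
      "(\<lambda>n. F (x n) + blinfun_apply y (x n)) \<longlonglongrightarrow> psup (blinfun_apply y)"
    and h: "\<And>n. norm (h n :: 'a \<Rightarrow>\<^sub>L real) \<le> 1" "\<And>m n. m < n \<Longrightarrow> blinfun_apply (h n) (x m) = 0"
      "\<And>m n. n < m \<Longrightarrow> \<epsilon> / 2 / 2 \<le> blinfun_apply (h n) (x m)"
    using escaping_sequence[OF V att large half_gt_zero[OF \<epsilon>]] by blast
  obtain r where r: "0 < r" "ball y r \<subseteq> V" using V(1) y by (auto simp: open_contains_ball)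
  define K where "K = r / 8"
  have K: "0 < K" "4 * K < r" using r by (auto simp: K_def)
  interpret P: bounded_payoff D "\<lambda>x. F x + blinfun_apply y x" R "M + norm y * R"
  proof
    show "F x + blinfun_apply y x \<le> M + norm y * R" if "x \<in> D" for x
      using F_bound[OF that] blinfun_bound[OF that, of y] by simp
  qed (use D_nonempty D_bound R_pos in auto)
  have Ppsup: "P.psup \<psi> = psup (\<lambda>x. blinfun_apply y x + \<psi> x)" for \<psi>
    by (simp add: P.psup_def psup_def add.assoc)
  have "\<exists>\<phi>. norm \<phi> \<le> 4 * K \<and> \<not> P.attained \<phi>"
  proof (rule P.james_nonattaining[of "\<lambda>n. K *\<^sub>R h n" K "K * (\<epsilon> / 2 / 2)" x])
    show "norm (K *\<^sub>R h n) \<le> K" for n using h(1)[of n] K mult_left_mono[of "norm (h n)" 1 K] by simp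
    show "0 < K * (\<epsilon> / 2 / 2)" using K \<epsilon> by simp
    show "(\<lambda>n. F (x n) + blinfun_apply y (x n)) \<longlonglongrightarrow> P.psup (\<lambda>_. 0)" using x(2) by (simp add: Ppsup)
    show "K * (\<epsilon> / 2 / 2) \<le> blinfun_apply (K *\<^sub>R h n) (x m)" if "n < m" for m n
      using mult_left_mono[OF h(3)[OF that], of K] K by (simp add: blinfun.scaleR_left)
  qed (use K x h in \<open>auto simp: blinfun.scaleR_left\<close>)
  then obtain \<phi> where \<phi>: "norm \<phi> \<le> 4 * K" "\<not> P.attained \<phi>" by blast
  then have "y + \<phi> \<in> V" using K r by (auto simp: dist_norm subset_iff)
  then have "attained (y + \<phi>)" by (rule att)
  moreover have "blinfun_apply (y + \<phi>) = (\<lambda>x. blinfun_apply y x + blinfun_apply \<phi> x)"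
    by (simp add: fun_eq_iff blinfun.add_left)
  ultimately show False using \<phi>(2) by (simp add: attained_def P.attained_def Ppsup add.assoc)
qed

end

text \<open>
  The slices of the unlocalized problem. Comparing with all points instead of the supremum keeps the
  definition free of suprema that may be infinite.
\<close>

definition near_max ::
  "'a::real_normed_vector set \<Rightarrow> ('a \<Rightarrow> real) \<Rightarrow> ('a \<Rightarrow>\<^sub>L real) \<Rightarrow> real \<Rightarrow> 'a set" where
  "near_max D F z \<delta> =
     {x \<in> D. \<forall>x'\<in>D. F x' + blinfun_apply z x' < F x + blinfun_apply z x + \<delta>}"

locale attaining_on_open =
  fixes D :: "'a::real_normed_vector set" and F :: "'a \<Rightarrow> real" and A :: "('a \<Rightarrow>\<^sub>L real) set"
  assumes D_nonempty: "D \<noteq> {}" and open_A: "open A"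
    and maximizer: "z \<in> A \<Longrightarrow> \<exists>x\<in>D. \<forall>x'\<in>D. F x' + blinfun_apply z x' \<le> F x + blinfun_apply z x"
begin

text \<open>
  The conjugate is locally bounded on \<open>A\<close>. Its sublevel sets are closed and cover \<open>A\<close>, so one
  of them contains a ball around some \<open>z0\<close>. A small ball around \<open>y\<close> consists of convex
  combinations, with fixed weights, of points of that ball and of one point of \<open>A\<close> behind \<open>y\<close>
  as seen from \<open>z0\<close>.
\<close>

lemma locally_uniform_bound:
  assumes y: "y \<in> A"
  obtains r M where "0 < r" "\<And>z x. z \<in> ball y r \<Longrightarrow> x \<in> D \<Longrightarrow> F x + blinfun_apply z x \<le> M"
proof -
  obtain r0 where r0: "0 < r0" "ball y r0 \<subseteq> A" using open_A y by (auto simp: open_contains_ball)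
  define B where "B n = {z. \<forall>x\<in>D. F x + blinfun_apply z x \<le> real n}" for n
  have closed_B: "\<forall>E\<in>range B. closed E"
  proof (rule ballI, erule rangeE, erule ssubst)
    fix n
    have "B n = (\<Inter>x\<in>D. {z. F x + blinfun_apply z x \<le> real n})" by (auto simp: B_def)
    then show "closed (B n)" by (auto intro!: closed_INT closed_Collect_le continuous_intros)
  qed
  have cover_B: "ball y r0 \<subseteq> \<Union>(range B)"
  proof
    fix z assume "z \<in> ball y r0"
    then obtain x where x: "\<forall>x'\<in>D. F x' + blinfun_apply z x' \<le> F x + blinfun_apply z x"
      using maximizer r0 by blast
    obtain n where "F x + blinfun_apply z x \<le> real n" using real_arch_simple by blast
    then have "z \<in> B n" using x by (force simp: B_def)
    then show "z \<in> \<Union>(range B)" by blast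
  qed
  have "\<exists>E\<in>range B. \<exists>z. \<exists>t>0. ball z t \<subseteq> E"
    by (rule Baire_ball_cover[OF r0(1) _ closed_B cover_B]) simp
  then obtain n z0 t where n: "0 < t" "ball z0 t \<subseteq> B n" by blast
  define \<tau> where "\<tau> = r0 / (2 * (norm (y - z0) + 1))"
  have \<tau>: "0 < \<tau>" using r0 by (simp add: \<tau>_def add_nonneg_pos)
  have "\<tau> * norm (y - z0) < r0"
  proof -
    have "norm (y - z0) / (2 * (norm (y - z0) + 1)) < 1" by (simp add: divide_simps add_nonneg_pos)
    then have "r0 * (norm (y - z0) / (2 * (norm (y - z0) + 1))) < r0 * 1" using r0 by (intro mult_strict_left_mono) auto
    then show ?thesis by (simp add: \<tau>_def)
  qed
  then have "y + \<tau> *\<^sub>R (y - z0) \<in> A" using r0 \<tau> by (auto simp: dist_norm subset_iff)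
  from maximizer[OF this] obtain M1 where
    M1: "\<And>x. x \<in> D \<Longrightarrow> F x + blinfun_apply (y + \<tau> *\<^sub>R (y - z0)) x \<le> M1" by blast
  define a b where "a = 1 / (1 + \<tau>)" and "b = \<tau> / (1 + \<tau>)"
  have ab: "0 < a" "0 < b" "a + b = 1" using \<tau> by (auto simp: a_def b_def field_simps)
  have abt: "a * \<tau> = b" by (simp add: a_def b_def)
  show ?thesis
  proof (rule that[of "b * t" "a * M1 + b * real n"])
    show "0 < b * t" using ab n by simp
    fix z x assume z: "z \<in> ball y (b * t)" and x: "x \<in> D"
    define u where "u = (1 / b) *\<^sub>R (z - y)"
    have "norm u = norm (z - y) / b" using ab by (simp add: u_def)
    also have "\<dots> < t" using z ab by (simp add: dist_norm norm_minus_commute pos_divide_less_eq mult.commute)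
    finally have "z0 + u \<in> B n" using n by (auto simp: dist_norm subset_iff)
    then have le0: "F x + blinfun_apply (z0 + u) x \<le> real n" using x by (simp add: B_def)
    have "z = a *\<^sub>R (y + \<tau> *\<^sub>R (y - z0)) + b *\<^sub>R (z0 + u)"
    proof -
      have "a *\<^sub>R (y + \<tau> *\<^sub>R (y - z0)) + b *\<^sub>R (z0 + u) = (a + b) *\<^sub>R y + b *\<^sub>R u"
        by (simp add: algebra_simps abt flip: scaleR_scaleR) (simp add: abt flip: scaleR_add_left)
      then show ?thesis using ab by (simp add: u_def)
    qed
    from arg_cong[OF this, of "\<lambda>w. blinfun_apply w x"]
    have "blinfun_apply z x = a * blinfun_apply (y + \<tau> *\<^sub>R (y - z0)) x + b * blinfun_apply (z0 + u) x"
      by (simp only: blinfun.add_left blinfun.scaleR_left real_scaleR_def)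
    moreover have "F x = a * F x + b * F x" using ab(3) by (metis distrib_right mult_1)
    ultimately have "F x + blinfun_apply z x = a * (F x + blinfun_apply (y + \<tau> *\<^sub>R (y - z0)) x) + b * (F x + blinfun_apply (z0 + u) x)"
      unfolding distrib_left by linarith
    also have "\<dots> \<le> a * M1 + b * real n"
      using M1[OF x] le0 ab by (intro add_mono mult_left_mono) auto
    finally show "F x + blinfun_apply z x \<le> a * M1 + b * real n" .
  qed
qed

text \<open>
  Near-maximizers for functionals close to \<open>y\<close> are uniformly bounded: if \<open>x\<close> nearly maximizes
  \<open>F + z\<close> and \<open>u\<close> norms \<open>x\<close>, then the local bound at \<open>z + (r0 / 3) u\<close> controls
  \<open>r0 / 3 * norm x\<close>. Cutting \<open>D\<close> down to a large ball therefore changes neither the maxima nor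
  the slices of depth at most one.
\<close>

lemma localization:
  assumes y: "y \<in> A"
  shows "\<exists>\<rho> D' R M. 0 < \<rho> \<and> ball y \<rho> \<subseteq> A \<and> bounded_payoff D' F R M \<and>
    (\<forall>z\<in>ball y \<rho>. bounded_payoff.attained D' F z \<and>
       (\<forall>\<delta>. 0 < \<delta> \<longrightarrow> \<delta> \<le> 1 \<longrightarrow> near_max D F z \<delta> = bounded_payoff.slice D' F z \<delta>))"
proof -
  obtain r0 M where r0: "0 < r0" "\<And>z x. z \<in> ball y r0 \<Longrightarrow> x \<in> D \<Longrightarrow> F x + blinfun_apply z x \<le> M"
    using locally_uniform_bound[OF y] by metis
  obtain r1 where r1: "0 < r1" "ball y r1 \<subseteq> A" using open_A y by (auto simp: open_contains_ball)
  obtain x1 where x1: "x1 \<in> D" using D_nonempty by blast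
  define \<rho> where "\<rho> = min (r0 / 2) r1"
  have \<rho>: "0 < \<rho>" "ball y \<rho> \<subseteq> A" "\<rho> \<le> r0 / 2" using r0 r1 by (auto simp: \<rho>_def)
  define R where "R = max (norm x1 + 1) ((M + 1 - F x1 + (norm y + \<rho>) * norm x1) * 3 / r0)"
  have R: "0 < R" "norm x1 \<le> R" by (auto simp: R_def add_nonneg_pos less_max_iff_disj)
  have near_bounded: "norm x \<le> R"
    if z: "z \<in> ball y \<rho>" and x: "x \<in> D" and near: "F x1 + blinfun_apply z x1 - 1 \<le> F x + blinfun_apply z x" for z x
  proof -
    obtain u :: "'a \<Rightarrow>\<^sub>L real" where u: "blinfun_apply u x = norm x" "norm u \<le> 1"
      by (rule norming_functional)
    have shift: "dist y (z + v) \<le> dist y z + norm v" for v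
      using dist_triangle[of y "z + v" z] by (simp add: dist_norm)
    have small: "norm ((r0 / 3) *\<^sub>R u) \<le> r0 / 3" using u(2) r0(1) by simp
    have "dist y z < \<rho>" using z by simp
    then have "dist y (z + (r0 / 3) *\<^sub>R u) < r0"
      using shift[of "(r0 / 3) *\<^sub>R u"] small \<rho>(3) r0(1) by linarith
    then have "F x + blinfun_apply (z + (r0 / 3) *\<^sub>R u) x \<le> M" using r0(2) x by simp
    then have "F x + blinfun_apply z x + r0 / 3 * norm x \<le> M"
      by (simp add: blinfun.add_left blinfun.scaleR_left u(1))
    moreover have "- blinfun_apply z x1 \<le> (norm y + \<rho>) * norm x1"
    proof -
      have "norm z \<le> norm y + \<rho>" using z norm_triangle_ineq2[of z y] by (simp add: dist_norm norm_minus_commute)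
      then have "norm z * norm x1 \<le> (norm y + \<rho>) * norm x1" by (intro mult_right_mono) auto
      then show ?thesis using norm_blinfun[of z x1] by simp
    qed
    ultimately have "r0 / 3 * norm x \<le> M + 1 - F x1 + (norm y + \<rho>) * norm x1" using near by simp
    then have "norm x \<le> (M + 1 - F x1 + (norm y + \<rho>) * norm x1) * 3 / r0"
      using r0(1) by (simp add: field_simps)
    then show ?thesis by (simp add: R_def)
  qed
  define D' where "D' = {x \<in> D. norm x \<le> R}"
  interpret B: bounded_payoff D' F R "M + norm y * R"
  proof
    show "F x \<le> M + norm y * R" if "x \<in> D'" for x
    proof -
      have "F x + blinfun_apply y x \<le> M" using r0 that by (simp add: D'_def)
      moreover have "norm y * norm x \<le> norm y * R" using that by (intro mult_left_mono) (auto simp: D'_def)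
      ultimately show ?thesis using norm_blinfun[of y x] by simp
    qed
  qed (use x1 R in \<open>auto simp: D'_def\<close>)
  have "B.attained z \<and> (\<forall>\<delta>. 0 < \<delta> \<longrightarrow> \<delta> \<le> 1 \<longrightarrow> near_max D F z \<delta> = B.slice z \<delta>)" if z: "z \<in> ball y \<rho>" for z
  proof -
    obtain x where x: "x \<in> D" "\<And>x'. x' \<in> D \<Longrightarrow> F x' + blinfun_apply z x' \<le> F x + blinfun_apply z x"
      using maximizer[of z] z \<rho>(2) by blast
    have "norm x \<le> R" using near_bounded[OF z x(1)] x(2)[OF x1] by simp
    then have xD': "x \<in> D'" using x(1) by (simp add: D'_def)
    have max: "B.psup (blinfun_apply z) = F x + blinfun_apply z x"
      by (intro antisym B.psup_least B.psup_upper B.bdd_blinfun xD' x(2)) (simp add: D'_def)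
    have "near_max D F z \<delta> = B.slice z \<delta>" if \<delta>: "0 < \<delta>" "\<delta> \<le> 1" for \<delta>
    proof
      show "near_max D F z \<delta> \<subseteq> B.slice z \<delta>"
      proof
        fix w assume w: "w \<in> near_max D F z \<delta>"
        then have "F x + blinfun_apply z x < F w + blinfun_apply z w + \<delta>" "w \<in> D"
          using x(1) by (auto simp: near_max_def)
        moreover from this have "norm w \<le> R" using near_bounded[OF z, of w] x(2)[OF x1] \<delta> by simp
        ultimately have "F x + blinfun_apply z x < F w + blinfun_apply z w + \<delta>" "w \<in> D'"
          by (auto simp: D'_def)
        then show "w \<in> B.slice z \<delta>" by (simp add: B.slice_def max)
      qed
      show "B.slice z \<delta> \<subseteq> near_max D F z \<delta>"
      proof
        fix w assume "w \<in> B.slice z \<delta>"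
        then have w: "w \<in> D'" "F x + blinfun_apply z x < F w + blinfun_apply z w + \<delta>"
          by (auto simp: B.slice_def max)
        then have "w \<in> D" by (simp add: D'_def)
        with w(2) x(2) show "w \<in> near_max D F z \<delta>" by (force simp: near_max_def)
      qed
    qed
    then show ?thesis using xD' max by (auto simp: B.attained_def)
  qed
  then show ?thesis using \<rho>(1,2) B.bounded_payoff_axioms by blast
qed

definition small_slice_set :: "nat \<Rightarrow> ('a \<Rightarrow>\<^sub>L real) set" where
  "small_slice_set n = {z \<in> A. \<exists>\<eta>>0. \<exists>q. near_max D F z \<eta> \<subseteq> cball q (1 / Suc n)}"

lemma near_max_mono: "\<delta> \<le> \<delta>' \<Longrightarrow> near_max D F z \<delta> \<subseteq> near_max D F z \<delta>'"
  by (fastforce simp: near_max_def)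

lemma open_small_slice_set: "open (small_slice_set n)"
  unfolding open_contains_ball
proof
  fix z assume "z \<in> small_slice_set n"
  then obtain \<eta> q where zA: "z \<in> A" and \<eta>: "0 < \<eta>" "near_max D F z \<eta> \<subseteq> cball q (1 / Suc n)"
    by (auto simp: small_slice_set_def)
  obtain \<rho> D' R M where \<rho>: "0 < \<rho>" "ball z \<rho> \<subseteq> A" "bounded_payoff D' F R M"
    and loc: "\<And>v \<delta>. v \<in> ball z \<rho> \<Longrightarrow> 0 < \<delta> \<Longrightarrow> \<delta> \<le> 1 \<Longrightarrow> near_max D F v \<delta> = bounded_payoff.slice D' F v \<delta>"
    using localization[OF zA] by blast
  interpret B: bounded_payoff D' F R M by fact
  define \<delta> where "\<delta> = min \<eta> 1"
  have \<delta>: "0 < \<delta>" "\<delta> \<le> 1" "\<delta> \<le> \<eta>" using \<eta> by (auto simp: \<delta>_def)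
  define e where "e = min \<rho> (\<delta> / (4 * R))"
  have "ball z e \<subseteq> small_slice_set n"
  proof
    fix v assume v: "v \<in> ball z e"
    then have v\<rho>: "v \<in> ball z \<rho>" by (simp add: e_def)
    have "dist v z < \<delta> / (4 * R)" using v by (simp add: e_def dist_commute)
    then have "\<delta> / 2 + 2 * (dist v z * R) \<le> \<delta>" using B.R_pos by (simp add: field_simps)
    then have "B.slice v (\<delta> / 2) \<subseteq> B.slice z \<delta>" by (rule B.slice_subset_slice)
    then have "near_max D F v (\<delta> / 2) \<subseteq> near_max D F z \<delta>"
      using loc[OF v\<rho>, of "\<delta> / 2"] loc[of z \<delta>] \<delta> \<rho> by simp
    also have "\<dots> \<subseteq> cball q (1 / Suc n)" using near_max_mono[OF \<delta>(3)] \<eta>(2) by blast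
    finally show "v \<in> small_slice_set n"
      using v\<rho> \<rho>(2) half_gt_zero[OF \<delta>(1)] unfolding small_slice_set_def by blast
  qed
  moreover have "0 < e" using \<rho> \<delta> B.R_pos by (simp add: e_def)
  ultimately show "\<exists>e>0. ball z e \<subseteq> small_slice_set n" by blast
qed

lemma dense_small_slice_set: "A \<subseteq> closure (small_slice_set n)"
proof
  fix y assume y: "y \<in> A"
  obtain \<rho> D' R M where \<rho>: "0 < \<rho>" "ball y \<rho> \<subseteq> A" "bounded_payoff D' F R M"
    and att: "\<And>v. v \<in> ball y \<rho> \<Longrightarrow> bounded_payoff.attained D' F v"
    and loc: "\<And>v \<delta>. v \<in> ball y \<rho> \<Longrightarrow> 0 < \<delta> \<Longrightarrow> \<delta> \<le> 1 \<Longrightarrow> near_max D F v \<delta> = bounded_payoff.slice D' F v \<delta>"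
    using localization[OF y] by blast
  interpret B: bounded_payoff D' F R M by fact
  show "y \<in> closure (small_slice_set n)"
    unfolding closure_approachable
  proof (intro allI impI)
    fix e :: real assume e: "0 < e"
    define V where "V = ball y (min e \<rho>)"
    have V: "open V" "V \<noteq> {}" "V \<subseteq> ball y \<rho>" using e \<rho> by (auto simp: V_def)
    obtain z \<eta> q where z: "z \<in> V" "0 < \<eta>" "B.slice z \<eta> \<subseteq> cball q (1 / Suc n)"
      using B.ex_small_slice[OF V(1,2), of "1 / Suc n"] att V(3) by (auto simp: subset_iff)
    have "near_max D F z (min \<eta> 1) = B.slice z (min \<eta> 1)" using loc z V by auto
    also have "\<dots> \<subseteq> B.slice z \<eta>" by (rule B.slice_subset_slice) simp
    finally have "near_max D F z (min \<eta> 1) \<subseteq> cball q (1 / Suc n)" using z(3) by blast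
    moreover have "0 < min \<eta> 1" using z(2) by simp
    ultimately have "z \<in> small_slice_set n"
      using z(1) V(3) \<rho>(2) unfolding small_slice_set_def by blast
    moreover have "dist z y < e" using z(1) by (simp add: V_def dist_commute)
    ultimately show "\<exists>z\<in>small_slice_set n. dist z y < e" by blast
  qed
qed

text \<open>
  The Baire category theorem in the whole dual space, after the complement of the closure of
  \<open>A\<close> has been added to each set to make it dense there.
\<close>

lemma dense_Inter_small_slice_set: "A \<subseteq> closure (\<Inter>n. small_slice_set n)"
proof
  fix y assume y: "y \<in> A"
  define T where "T n = small_slice_set n \<union> - closure A" for n
  have "Met_TC.mtopology closure_of \<Inter>(range T) = UNIV"
  proof (rule Met_TC.metric_Baire_category)
    fix S assume "S \<in> range T"
    then obtain n where S: "S = T n" by blast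
    have "closure A \<subseteq> closure (small_slice_set n)"
      using closure_mono[OF dense_small_slice_set[of n]] by simp
    then have "closure (T n) = UNIV" using closure_subset[of "- closure A"] by (auto simp: T_def closure_Un)
    then show "openin Met_TC.mtopology S \<and> Met_TC.mtopology closure_of S = UNIV"
      using open_small_slice_set[of n] by (simp add: S T_def open_Un open_Compl)
  qed (auto simp: complete_UNIV)
  then have dense: "closure (\<Inter>n. T n) = UNIV" by simp
  show "y \<in> closure (\<Inter>n. small_slice_set n)"
    unfolding closure_approachable
  proof (intro allI impI)
    fix e :: real assume e: "0 < e"
    obtain r where r: "0 < r" "ball y r \<subseteq> A" using open_A y by (auto simp: open_contains_ball)
    have "y \<in> closure (\<Inter>n. T n)" using dense by simp
    moreover have "0 < min e r" using e r by simp
    ultimately obtain z where z: "z \<in> (\<Inter>n. T n)" "dist z y < min e r"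
      unfolding closure_approachable by blast
    have "z \<in> A" using z(2) r(2) by (auto simp: dist_commute subset_iff)
    then have "z \<in> (\<Inter>n. small_slice_set n)" using z(1) closure_subset[of A] by (auto simp: T_def)
    then show "\<exists>z\<in>\<Inter>n. small_slice_set n. dist z y < e" using z(2) by auto
  qed
qed

end

section \<open>Strong maxima\<close>

text \<open>
  Any two points of a small slice are close, and the tail of a maximizing sequence lies in
  every slice, together with the maximizer. So the sequence converges to the maximizer itself.
\<close>

lemma strong_maximum_if_small_slices:
  fixes f :: "'a::real_normed_vector \<Rightarrow> ereal"
  assumes f: "\<And>x. f x \<noteq> -\<infinity>" "eff_dom f \<noteq> {}" and x0: "x0 \<in> argmax (dual_minus z f)"
    and small: "\<And>n. \<exists>\<eta>>0. \<exists>q. near_max (eff_dom f) (\<lambda>x. - real_of_ereal (f x)) z \<eta> \<subseteq> cball q (1 / real (Suc n))"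
  shows "strong_maximum_at (dual_minus z f) x0"
proof -
  let ?g = "dual_minus z f"
  have fin: "?g x = ereal (- real_of_ereal (f x) + blinfun_apply z x)" if "x \<in> eff_dom f" for x
    using that f(1)[of x] by (cases "f x") (auto simp: dual_minus_def eff_dom_def)
  have inf: "?g x = -\<infinity>" if "x \<notin> eff_dom f" for x
    using that by (cases "f x") (auto simp: dual_minus_def eff_dom_def)
  have le: "?g x \<le> ?g x0" for x using x0 by (simp add: argmax_def)
  have x0D: "x0 \<in> eff_dom f"
  proof (rule ccontr)
    assume "x0 \<notin> eff_dom f"
    moreover obtain x where "x \<in> eff_dom f" using f(2) by blast
    ultimately show False using le[of x] fin[of x] inf[of x0] by simp
  qed
  have sup: "(SUP x. ?g x) = ?g x0" using le by (intro antisym SUP_least SUP_upper) auto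
  have "s \<longlonglongrightarrow> x0" if s: "(\<lambda>n. ?g (s n)) \<longlonglongrightarrow> ?g x0" for s
  proof (rule metric_LIMSEQ_I)
    fix e :: real assume "0 < e"
    then obtain n where n: "1 / Suc n < e / 2" using nat_approx_posE[of "e / 2"] by auto
    obtain \<eta> q where \<eta>: "0 < \<eta>" and sub: "near_max (eff_dom f) (\<lambda>x. - real_of_ereal (f x)) z \<eta> \<subseteq> cball q (1 / real (Suc n))"
      using small[of n] by blast
    have near: "x \<in> cball q (1 / real (Suc n))" if x: "?g x0 - ereal \<eta> < ?g x" for x
    proof -
      have xD: "x \<in> eff_dom f" using x inf[of x] by (cases "x \<in> eff_dom f") auto
      have "- real_of_ereal (f x') + blinfun_apply z x' < - real_of_ereal (f x) + blinfun_apply z x + \<eta>"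
        if "x' \<in> eff_dom f" for x'
        using x le[of x'] by (simp add: fin that xD x0D)
      then show ?thesis using sub xD by (auto simp: near_max_def)
    qed
    have lt: "?g x0 - ereal \<eta> < ?g x0" using \<eta> by (simp add: fin x0D)
    have "\<forall>\<^sub>F k in sequentially. ?g x0 - ereal \<eta> < ?g (s k)" using order_tendstoD(1)[OF s lt] .
    then obtain N where N: "\<And>k. N \<le> k \<Longrightarrow> ?g x0 - ereal \<eta> < ?g (s k)" by (auto simp: eventually_sequentially)
    have "dist (s k) x0 < e" if "N \<le> k" for k
      using near[OF N[OF that]] near[OF lt] n dist_triangle2[of "s k" x0 q] by (simp add: dist_commute)
    then show "\<exists>N. \<forall>k\<ge>N. dist (s k) x0 < e" by blast
  qed
  then show ?thesis using sup by (simp add: strong_maximum_at_def)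
qed

theorem theorem5p6:
  fixes f :: "'a::banach \<Rightarrow> ereal"
    and A :: "('a \<Rightarrow>\<^sub>L real) set"
  assumes "\<And>x. f x \<noteq> -\<infinity>"
    and "proper_fun f"
    and "A \<noteq> {}" and "open A"
    and "A \<subseteq> eff_dom (fenchel_conjugate f)"
    and "\<And>xs. xs \<in> A \<Longrightarrow> argmax (dual_minus xs f) \<noteq> {}"
  shows "(\<exists>R'. R' \<subseteq> A \<and> top_of_set A closure_of R' = A \<and> gdelta_in (top_of_set A) R' \<and>
             (\<forall>xs\<in>R'. has_strong_maximum (dual_minus xs f))) \<and>
         (\<forall>\<epsilon>::real. 0 \<in> A \<longrightarrow> \<epsilon> > 0 \<longrightarrow>
             (\<exists>x0s. norm x0s < \<epsilon> \<and> has_strong_maximum (dual_minus x0s f)))"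
proof -
  let ?D = "eff_dom f" and ?F = "\<lambda>x. - real_of_ereal (f x)"
  have ne: "?D \<noteq> {}" using assms(2) by (simp add: proper_fun_def)
  have fin: "dual_minus z f x = ereal (?F x + blinfun_apply z x)" if "x \<in> ?D" for x z
    using that assms(1)[of x] by (cases "f x") (auto simp: dual_minus_def eff_dom_def)
  interpret attaining_on_open ?D ?F A
  proof
    fix z assume "z \<in> A"
    then obtain x where x: "\<And>x'. dual_minus z f x' \<le> dual_minus z f x"
      using assms(6) by (auto simp: argmax_def)
    have "x \<in> ?D"
    proof (rule ccontr)
      assume "x \<notin> ?D"
      then have "dual_minus z f x = -\<infinity>" by (cases "f x") (auto simp: dual_minus_def eff_dom_def)
      moreover obtain w where "w \<in> ?D" using ne by blast
      ultimately show False using x[of w] fin[of w z] by simp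
    qed
    then show "\<exists>x\<in>?D. \<forall>x'\<in>?D. ?F x' + blinfun_apply z x' \<le> ?F x + blinfun_apply z x"
      using x fin[of _ z] by (metis ereal_less_eq(3))
  qed (fact ne assms(4))+
  define R' where "R' = (\<Inter>n. small_slice_set n)"
  have sub: "R' \<subseteq> A" by (auto simp: R'_def small_slice_set_def)
  have strong: "has_strong_maximum (dual_minus z f)" if z: "z \<in> R'" for z
  proof -
    obtain x0 where "x0 \<in> argmax (dual_minus z f)" using assms(6) sub z by blast
    then have "strong_maximum_at (dual_minus z f) x0"
      by (rule strong_maximum_if_small_slices[OF assms(1) ne])
        (use z in \<open>auto simp: R'_def small_slice_set_def\<close>)
    then show ?thesis by (auto simp: has_strong_maximum_def)
  qed
  have dense: "A \<subseteq> closure R'" unfolding R'_def by (rule dense_Inter_small_slice_set)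
  have "top_of_set A closure_of R' = A"
    using sub dense by (auto simp: closure_of_subtopology Int_absorb1)
  moreover have "gdelta_in (top_of_set A) R'"
    unfolding R'_def
  proof (rule gdelta_in_Inter)
    fix S assume "S \<in> range small_slice_set"
    then obtain n where "S = small_slice_set n" by blast
    then show "gdelta_in (top_of_set A) S"
      using open_small_slice_set[of n]
      by (auto intro!: open_imp_gdelta_in open_subset simp: small_slice_set_def)
  qed auto
  moreover have "\<exists>z. norm z < \<epsilon> \<and> has_strong_maximum (dual_minus z f)" if zero: "0 \<in> A" and \<epsilon>: "0 < \<epsilon>" for \<epsilon> :: real
  proof -
    have "0 \<in> closure R'" using dense zero by blast
    then obtain z where "z \<in> R'" "dist z 0 < \<epsilon>" using \<epsilon> unfolding closure_approachable by blast
    then show ?thesis using strong by auto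
  qed
  ultimately show ?thesis using sub strong by blast
qed

end
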